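(* Let $f=1+\sum_{|\alpha|\ge1}b_\alpha Z_\alpha$ be an admissible free holomorphic function such that $\frac{b_\alpha}{b_{g_i\alpha}}\le1$ for any $i\in\{1,\ldots,n\}$ and $\alpha\in\mathbb F_n^+$, with universal model ${\bf W}^{(f)}=(W_1^{(f)},\ldots,W_n^{(f)})$. Let $\mathcal K$ be a Hilbert space and let $\mathcal M\subset F^2(H_n)\otimes\mathcal K$ be a closed subspace. Then the following statements are equivalent. (i) $\mathcal M$ is a joint invariant subspace under $W_1^{(f)}\otimes I_{\mathcal K},\ldots,W_n^{(f)}\otimes I_{\mathcal K}$. (ii) There is a Hilbert space $\mathcal D$ and a partial isometry $\Psi:F^2(H_n)\otimes\mathcal D\to F^2(H_n)\otimes\mathcal K$ such that $$\mathcal M=\Psi(F^2(H_n)\otimes\mathcal D)\quad\text{and}\quad \Psi(S_i\otimes I_{\mathcal D})=(W_i^{(f)}\otimes I_{\mathcal K})\Psi,\qquad i\in\{1,\ldots,n\},$$ where $S_1,\ldots,S_n$ are the left creation operators on the full Fock space $F^2(H_n)$.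
   Context: Fix an integer $n\ge 1$ and an $n$-dimensional complex Hilbert space $H_n$ with orthonormal basis $e_1,\ldots,e_n$. The full Fock space is $F^2(H_n)=\bigoplus_{k\ge0}H_n^{\otimes k}$ with $H_n^{\otimes 0}=\mathbb C1$. The left creation operators are $S_i\varphi=e_i\otimes\varphi$. $\mathbb F_n^+$ is the unital free semigroup on generators $g_1,\ldots,g_n$ with identity $g_0$; $|\alpha|$ is the length of $\alpha$ ($|g_0|=0$). For $\alpha=g_{i_1}\cdots g_{i_k}$ put $e_\alpha=e_{i_1}\otimes\cdots\otimes e_{i_k}$, $e_{g_0}=1$, and for operators or indeterminates put $X_\alpha=X_{i_1}\cdots X_{i_k}$, $X_{g_0}=I$. A formal power series $f=1+\sum_{|\alpha|\ge1}b_\alpha Z_\alpha$ in noncommuting indeterminates $Z_1,\ldots,Z_n$ is an admissible free holomorphic function if: (a) $b_\alpha>0$ for all $\alpha$, $b_{g_0}=1$, and $\sup_{\alpha}\frac{b_\alpha}{b_{g_i\alpha}}<\infty$ for each $i$; (b) $\limsup_{k\to\infty}\big(\sum_{|\alpha|=k}b_\alpha^2\big)^{1/2k}<\infty$; (c) $\sup_{k}\big\|\sum_{p=0}^k\sum_{|\alpha|=p}a_\alpha W_\alpha W_\alpha^*\big\|<\infty$, where $f^{-1}=1+\sum_{|\alpha|\ge1}a_\alpha Z_\alpha$ is the inverse of $f$ as a formal power series and ${\bf W}^{(f)}=(W_1,\ldots,W_n)$, the universal model of $f$, is the tuple of weighted left creation operators $W_i=S_iD_i$ with $D_ie_\alpha=\sqrt{b_\alpha/b_{g_i\alpha}}\,e_\alpha$.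 *)

theory Defs
  imports "HOL-Analysis.Analysis"
begin

section \<open>Complex Hilbert spaces\<close>

text \<open>
  A complex Hilbert space is a complete real inner product space together with a complex scalar
  multiplication extending the real one and a sesquilinear form (linear in the first argument)
  whose real part is the given real inner product.  Norm and topology are thereby those of the
  complex inner product, and everything available for \<^class>\<open>real_inner\<close> and
  \<^class>\<open>banach\<close> applies.
\<close>

class complex_hilbert = real_inner + complete_space +
  fixes scaleC :: "complex \<Rightarrow> 'a \<Rightarrow> 'a" (infixr "*\<^sub>C" 75)
    and cinner :: "'a \<Rightarrow> 'a \<Rightarrow> complex"
  assumes scaleC_add_right: "c *\<^sub>C (x + y) = c *\<^sub>C x + c *\<^sub>C y"
    and scaleC_add_left: "(c + d) *\<^sub>C x = c *\<^sub>C x + d *\<^sub>C x"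
    and scaleC_scaleC: "c *\<^sub>C (d *\<^sub>C x) = (c * d) *\<^sub>C x"
    and scaleR_scaleC: "r *\<^sub>R x = complex_of_real r *\<^sub>C x"
    and cinner_commute: "cinner x y = cnj (cinner y x)"
    and cinner_add_left: "cinner (x + y) z = cinner x z + cinner y z"
    and cinner_scaleC_left: "cinner (c *\<^sub>C x) y = c * cinner x y"
    and inner_eq_Re_cinner: "inner x y = Re (cinner x y)"

subclass (in complex_hilbert) banach ..

instantiation complex :: complex_hilbert
begin
definition scaleC_complex :: "complex \<Rightarrow> complex \<Rightarrow> complex" where
  "scaleC_complex c x = c * x"
definition cinner_complex :: "complex \<Rightarrow> complex \<Rightarrow> complex" where
  "cinner_complex x y = x * cnj y"
instance
  by standard (auto simp: scaleC_complex_def cinner_complex_def algebra_simps inner_complex_def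
      scaleR_conv_of_real)
end

lemma cinner_add_right: "cinner x (y + z) = cinner x y + cinner x z"
  for x y z :: "'a::complex_hilbert"
  by (metis cinner_add_left cinner_commute complex_cnj_add)

lemma cinner_scaleC_right: "cinner x (c *\<^sub>C y) = cnj c * cinner x y"
  for x y :: "'a::complex_hilbert"
  by (metis cinner_commute cinner_scaleC_left complex_cnj_mult)

lemma scaleC_one [simp]: "1 *\<^sub>C x = x" for x :: "'a::complex_hilbert"
  using scaleR_scaleC[of 1 x] by simp

lemma scaleC_zero_left [simp]: "0 *\<^sub>C x = 0" for x :: "'a::complex_hilbert"
  using scaleR_scaleC[of 0 x] by simp

lemma scaleC_zero_right [simp]: "c *\<^sub>C 0 = 0" for c :: complex
  using scaleC_add_right[of c 0 "0::'a::complex_hilbert"] by simp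

lemma norm_scaleC [simp]: "norm (c *\<^sub>C x) = cmod c * norm x" for x :: "'a::complex_hilbert"
proof -
  have "(norm (c *\<^sub>C x))\<^sup>2 = Re (c * (cnj c * cinner x x))"
    by (simp only: power2_norm_eq_inner inner_eq_Re_cinner cinner_scaleC_left
        cinner_scaleC_right mult.left_commute)
  also have "c * (cnj c * cinner x x) = complex_of_real ((cmod c)\<^sup>2) * cinner x x"
    unfolding complex_norm_square by (simp only: mult.assoc)
  also have "Re \<dots> = (cmod c)\<^sup>2 * (norm x)\<^sup>2"
    by (simp add: power2_norm_eq_inner inner_eq_Re_cinner del: of_real_power)
  also have "\<dots> = (cmod c * norm x)\<^sup>2"
    by (simp add: power_mult_distrib)
  finally show ?thesis
    by (simp add: power2_eq_iff_nonneg)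
qed

lemma cmod_cinner_le: "cmod (cinner x y) \<le> norm x * norm y" for x y :: "'a::complex_hilbert"
proof -
  define z where "z = cinner x y"
  define u where "u = (if z = 0 then 1 else cnj z / complex_of_real (cmod z))"
  have "cnj z * z = complex_of_real (cmod z) * complex_of_real (cmod z)"
    using complex_norm_square[of z] by (simp add: power2_eq_square mult.commute)
  then have u: "cmod u = 1" "u * cinner x y = complex_of_real (cmod (cinner x y))"
    unfolding z_def[symmetric] by (auto simp: u_def norm_divide)
  have "cmod (cinner x y) = inner (u *\<^sub>C x) y"
    using u by (simp add: inner_eq_Re_cinner cinner_scaleC_left)
  also have "\<dots> \<le> norm (u *\<^sub>C x) * norm y"
    by (rule norm_cauchy_schwarz)
  finally show ?thesis
    using u by simp
qed

definition csubspace :: "'a::complex_hilbert set \<Rightarrow> bool" where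
  "csubspace V \<longleftrightarrow> subspace V \<and> (\<forall>c. \<forall>x\<in>V. c *\<^sub>C x \<in> V)"

definition bounded_clinear :: "('a::complex_hilbert \<Rightarrow> 'b::complex_hilbert) \<Rightarrow> bool" where
  "bounded_clinear T \<longleftrightarrow> bounded_linear T \<and> (\<forall>c x. T (c *\<^sub>C x) = c *\<^sub>C T x)"

definition hilbert_adjoint ::
    "('a::complex_hilbert \<Rightarrow> 'b::complex_hilbert) \<Rightarrow> 'b \<Rightarrow> 'a" where
  "hilbert_adjoint T = (THE T'. \<forall>x y. cinner (T x) y = cinner x (T' y))"

text \<open>
  Partial isometries whose initial Hilbert space is a closed subspace \<open>V\<close> of a type;
  the values of \<open>\<Psi>\<close> outside \<open>V\<close> are irrelevant.
\<close>

definition partial_isometry_on ::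
    "'a::complex_hilbert set \<Rightarrow> ('a \<Rightarrow> 'b::complex_hilbert) \<Rightarrow> bool" where
  "partial_isometry_on V \<Psi> \<longleftrightarrow>
     (\<forall>x\<in>V. \<forall>y\<in>V. \<Psi> (x + y) = \<Psi> x + \<Psi> y) \<and>
     (\<forall>c. \<forall>x\<in>V. \<Psi> (c *\<^sub>C x) = c *\<^sub>C \<Psi> x) \<and>
     (\<exists>B. \<forall>x\<in>V. norm (\<Psi> x) \<le> B * norm x) \<and>
     (\<forall>x\<in>V. (\<forall>y\<in>V. \<Psi> y = 0 \<longrightarrow> cinner x y = 0) \<longrightarrow> norm (\<Psi> x) = norm x)"


section \<open>Hilbert space valued square-summable families\<close>

typedef (overloaded) ('i, 'k::complex_hilbert) l2 =
  "{x :: 'i \<Rightarrow> 'k. (\<lambda>i. (norm (x i))\<^sup>2) summable_on UNIV}"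
  morphisms coord Abs_l2
  by (rule exI[of _ "\<lambda>_. 0"]) simp

lemma l2_eqI: "(\<And>i. coord x i = coord y i) \<Longrightarrow> x = y"
  by (metis coord_inject ext)

lemma coord_summable: "(\<lambda>i. (norm (coord x i))\<^sup>2) summable_on UNIV"
  using coord[of x] by simp

lemma square_summable_add:
  fixes x y :: "'i \<Rightarrow> 'k::complex_hilbert"
  assumes "(\<lambda>i. (norm (x i))\<^sup>2) summable_on UNIV" "(\<lambda>i. (norm (y i))\<^sup>2) summable_on UNIV"
  shows "(\<lambda>i. (norm (x i + y i))\<^sup>2) summable_on UNIV"
proof (rule summable_on_comparison_test)
  show "(\<lambda>i. 2 * (norm (x i))\<^sup>2 + 2 * (norm (y i))\<^sup>2) summable_on UNIV"
    by (intro summable_on_add summable_on_cmult_right assms)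
  show "(norm (x i + y i))\<^sup>2 \<le> 2 * (norm (x i))\<^sup>2 + 2 * (norm (y i))\<^sup>2" for i
  proof -
    have "(norm (x i + y i))\<^sup>2 \<le> (norm (x i) + norm (y i))\<^sup>2"
      by (simp add: norm_triangle_ineq power_mono)
    also have "\<dots> \<le> 2 * (norm (x i))\<^sup>2 + 2 * (norm (y i))\<^sup>2"
      using sum_squares_bound[of "norm (x i)" "norm (y i)"] by (simp add: power2_sum)
    finally show ?thesis .
  qed
qed auto

lemma square_summable_scaleC:
  fixes x :: "'i \<Rightarrow> 'k::complex_hilbert"
  assumes "(\<lambda>i. (norm (x i))\<^sup>2) summable_on UNIV"
  shows "(\<lambda>i. (norm (c *\<^sub>C x i))\<^sup>2) summable_on UNIV"
  using summable_on_cmult_right[OF assms, of "(cmod c)\<^sup>2"] by (simp add: power_mult_distrib)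

lemma cinner_summable:
  fixes x y :: "'i \<Rightarrow> 'k::complex_hilbert"
  assumes "(\<lambda>i. (norm (x i))\<^sup>2) summable_on UNIV" "(\<lambda>i. (norm (y i))\<^sup>2) summable_on UNIV"
  shows "(\<lambda>i. cinner (x i) (y i)) summable_on UNIV"
proof (rule Infinite_Sum.abs_summable_summable, rule Infinite_Sum.abs_summable_on_comparison_test')
  show "(\<lambda>i. (norm (x i))\<^sup>2 + (norm (y i))\<^sup>2) summable_on UNIV"
    by (intro summable_on_add assms)
  show "cmod (cinner (x i) (y i)) \<le> (norm (x i))\<^sup>2 + (norm (y i))\<^sup>2" for i
    using cmod_cinner_le[of "x i" "y i"] sum_squares_bound[of "norm (x i)" "norm (y i)"]
      mult_nonneg_nonneg[OF norm_ge_zero norm_ge_zero, of "x i" "y i"]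
    by linarith
qed

instantiation l2 :: (type, complex_hilbert) real_vector
begin

definition "0 = Abs_l2 (\<lambda>_. 0)"
definition "x + y = Abs_l2 (\<lambda>i. coord x i + coord y i)"
definition "- x = Abs_l2 (\<lambda>i. - coord x i)" for x :: "('a, 'b) l2"
definition "x - y = Abs_l2 (\<lambda>i. coord x i - coord y i)"
definition "r *\<^sub>R x = Abs_l2 (\<lambda>i. r *\<^sub>R coord x i)" for x :: "('a, 'b) l2"

lemma coord_zero: "coord 0 i = 0"
  by (simp add: zero_l2_def Abs_l2_inverse)

lemma coord_add: "coord (x + y) i = coord x i + coord y i"
  by (simp add: plus_l2_def Abs_l2_inverse square_summable_add coord_summable)

lemma coord_uminus: "coord (- x) i = - coord x i"
  by (simp add: uminus_l2_def Abs_l2_inverse coord_summable)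

lemma coord_minus: "coord (x - y) i = coord x i - coord y i"
  using square_summable_add[OF coord_summable[of x] coord_summable[of "- y"]]
  by (simp add: minus_l2_def Abs_l2_inverse coord_uminus)

lemma coord_scaleR: "coord (r *\<^sub>R x) i = r *\<^sub>R coord x i"
  by (simp only: scaleR_l2_def scaleR_scaleC Abs_l2_inverse mem_Collect_eq
      square_summable_scaleC coord_summable)

instance
  by standard (auto intro!: l2_eqI simp: coord_zero coord_add coord_uminus coord_minus
      coord_scaleR algebra_simps)

end

instantiation l2 :: (type, complex_hilbert) real_inner
begin

definition "inner x y = (\<Sum>\<^sub>\<infinity>i. inner (coord x i) (coord y i))" for x :: "('a, 'b) l2"
definition "norm x = sqrt (inner x x)" for x :: "('a, 'b) l2"
definition "dist x y = norm (x - y)" for x :: "('a, 'b) l2"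
definition "sgn x = x /\<^sub>R norm x" for x :: "('a, 'b) l2"
definition "uniformity = (INF e\<in>{0 <..}. principal {(x :: ('a, 'b) l2, y). dist x y < e})"
definition "open U \<longleftrightarrow> (\<forall>x\<in>U. \<forall>\<^sub>F (x', y) in uniformity. x' = x \<longrightarrow> y \<in> U)"
  for U :: "('a, 'b) l2 set"

instance
proof
  fix x y z :: "('a, 'b) l2" and a :: real
  have summ: "(\<lambda>i. inner (coord x i) (coord y i)) summable_on UNIV" for x y :: "('a, 'b) l2"
    unfolding inner_eq_Re_cinner by (intro summable_on_Re cinner_summable coord_summable)
  show "sgn x = x /\<^sub>R norm x" by (rule sgn_l2_def)
  show "dist x y = norm (x - y)" by (rule dist_l2_def)
  show "uniformity = (INF e\<in>{0 <..}. principal {(x :: ('a, 'b) l2, y). dist x y < e})"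
    by (rule uniformity_l2_def)
  show "open U \<longleftrightarrow> (\<forall>x\<in>U. \<forall>\<^sub>F (x', y) in uniformity. x' = x \<longrightarrow> y \<in> U)"
    for U :: "('a, 'b) l2 set"
    by (rule open_l2_def)
  show "norm x = sqrt (inner x x)" by (rule norm_l2_def)
  show "inner x y = inner y x"
    unfolding inner_l2_def by (simp add: inner_commute)
  show "inner (x + y) z = inner x z + inner y z"
    unfolding inner_l2_def coord_add inner_add_left by (intro infsum_add summ)
  show "inner (a *\<^sub>R x) y = a * inner x y"
    unfolding inner_l2_def coord_scaleR inner_scaleR_left by (intro infsum_cmult_right summ)
  show "0 \<le> inner x x"
    unfolding inner_l2_def by (rule infsum_nonneg) simp
  show "inner x x = 0 \<longleftrightarrow> x = 0"
  proof
    assume "inner x x = 0"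
    then have "inner (coord x i) (coord x i) = 0" for i
      by (intro nonneg_infsum_le_0D[OF _ summ]) (auto simp: inner_l2_def)
    then show "x = 0"
      by (intro l2_eqI) (simp add: coord_zero)
  qed (simp add: inner_l2_def coord_zero)
qed

end

lemma norm_l2_square: "(norm x)\<^sup>2 = (\<Sum>\<^sub>\<infinity>i. (norm (coord x i))\<^sup>2)"
  by (simp add: power2_norm_eq_inner inner_l2_def)

lemma sum_coord_le_norm: "finite F \<Longrightarrow> (\<Sum>i\<in>F. (norm (coord x i))\<^sup>2) \<le> (norm x)\<^sup>2"
  unfolding norm_l2_square by (rule finite_sum_le_infsum) (auto intro: coord_summable)

lemma norm_coord_le: "norm (coord x i) \<le> norm x"
  by (rule power2_le_imp_le) (use sum_coord_le_norm[of "{i}" x] in simp_all)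

instance l2 :: (type, complex_hilbert) complete_space
proof
  fix X :: "nat \<Rightarrow> ('a, 'b) l2"
  assume "Cauchy X"
  then have C: "\<exists>N. \<forall>m\<ge>N. \<forall>n\<ge>N. norm (X m - X n) < e" if "e > 0" for e
    using that by (simp add: Cauchy_def dist_norm)
  have "Cauchy (\<lambda>n. coord (X n) i)" for i
  proof (rule metric_CauchyI)
    fix e :: real assume "e > 0"
    have "dist (coord (X m) i) (coord (X n) i) \<le> norm (X m - X n)" for m n
      using norm_coord_le[of "X m - X n" i] by (simp add: dist_norm coord_minus)
    with C[OF \<open>e > 0\<close>] show "\<exists>N. \<forall>m\<ge>N. \<forall>n\<ge>N. dist (coord (X m) i) (coord (X n) i) < e"
      by (meson le_less_trans)
  qed
  then have "\<exists>l. (\<lambda>n. coord (X n) i) \<longlonglongrightarrow> l" for i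
    using Cauchy_convergent convergent_def by blast
  then obtain L where L: "\<And>i. (\<lambda>n. coord (X n) i) \<longlonglongrightarrow> L i"
    by metis
  have fin: "(\<Sum>i\<in>F. (norm (coord (X m) i - L i))\<^sup>2) \<le> e\<^sup>2"
    if "\<forall>n\<ge>N. norm (X m - X n) < e" "finite F" for F m N e
  proof (rule LIMSEQ_le_const2)
    show "(\<lambda>n. \<Sum>i\<in>F. (norm (coord (X m) i - coord (X n) i))\<^sup>2)
        \<longlonglongrightarrow> (\<Sum>i\<in>F. (norm (coord (X m) i - L i))\<^sup>2)"
      by (intro tendsto_intros L)
    have "(\<Sum>i\<in>F. (norm (coord (X m) i - coord (X n) i))\<^sup>2) \<le> e\<^sup>2" if "n \<ge> N" for n
    proof -
      have "(\<Sum>i\<in>F. (norm (coord (X m) i - coord (X n) i))\<^sup>2) \<le> (norm (X m - X n))\<^sup>2"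
        using sum_coord_le_norm[OF \<open>finite F\<close>, of "X m - X n"] by (simp add: coord_minus)
      also have "\<dots> \<le> e\<^sup>2"
        using \<open>\<forall>n\<ge>N. norm (X m - X n) < e\<close> that by (intro power_mono) (auto intro: less_imp_le)
      finally show ?thesis .
    qed
    then show "\<exists>N. \<forall>n\<ge>N. (\<Sum>i\<in>F. (norm (coord (X m) i - coord (X n) i))\<^sup>2) \<le> e\<^sup>2"
      by blast
  qed
  have summ: "(\<lambda>i. (norm (coord (X m) i - L i))\<^sup>2) summable_on UNIV"
    if "\<forall>n\<ge>N. norm (X m - X n) < e" for m N e
    by (rule nonneg_bdd_above_summable_on) (use fin[OF that] in \<open>auto intro!: bdd_aboveI\<close>)
  obtain N where "\<forall>m\<ge>N. \<forall>n\<ge>N. norm (X m - X n) < 1"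
    using C[of 1] by auto
  then have "(\<lambda>i. (norm (L i - coord (X N) i))\<^sup>2) summable_on UNIV"
    using summ[of N N 1] by (simp add: norm_minus_commute)
  from square_summable_add[OF this coord_summable[of "X N"]]
  have L2: "coord (Abs_l2 L) = L"
    by (intro Abs_l2_inverse) simp
  have "\<exists>N. \<forall>n\<ge>N. dist (X n) (Abs_l2 L) < e" if "e > 0" for e
  proof -
    obtain N where N: "\<forall>m\<ge>N. \<forall>n\<ge>N. norm (X m - X n) < e / 2"
      using C[of "e / 2"] \<open>e > 0\<close> by auto
    have "dist (X m) (Abs_l2 L) < e" if "m \<ge> N" for m
    proof -
      have Nm: "\<forall>n\<ge>N. norm (X m - X n) < e / 2"
        using N that by blast
      have "(norm (X m - Abs_l2 L))\<^sup>2 \<le> (e / 2)\<^sup>2"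
        unfolding norm_l2_square coord_minus L2
        by (rule infsum_le_finite_sums[OF summ[OF Nm]]) (use fin[OF Nm] in auto)
      then have "norm (X m - Abs_l2 L) \<le> e / 2"
        by (rule power2_le_imp_le) (use \<open>e > 0\<close> in simp)
      then show ?thesis
        using \<open>e > 0\<close> by (simp add: dist_norm)
    qed
    then show ?thesis by blast
  qed
  then show "convergent X"
    unfolding convergent_def LIMSEQ_def by blast
qed

instantiation l2 :: (type, complex_hilbert) complex_hilbert
begin

definition "c *\<^sub>C x = Abs_l2 (\<lambda>i. c *\<^sub>C coord x i)" for x :: "('a, 'b) l2"
definition "cinner x y = (\<Sum>\<^sub>\<infinity>i. cinner (coord x i) (coord y i))" for x :: "('a, 'b) l2"

lemma coord_scaleC: "coord (c *\<^sub>C x) i = c *\<^sub>C coord x i"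
  by (simp only: scaleC_l2_def Abs_l2_inverse mem_Collect_eq square_summable_scaleC coord_summable)

lemmas coord_simps = coord_zero coord_add coord_scaleC coord_uminus coord_minus coord_scaleR

instance
proof
  fix x y z :: "('a, 'b) l2" and a :: real and c d :: complex
  show "c *\<^sub>C (x + y) = c *\<^sub>C x + c *\<^sub>C y" "(c + d) *\<^sub>C x = c *\<^sub>C x + d *\<^sub>C x"
    "c *\<^sub>C d *\<^sub>C x = (c * d) *\<^sub>C x" "a *\<^sub>R x = complex_of_real a *\<^sub>C x"
    by (auto intro!: l2_eqI simp: coord_simps scaleC_add_left scaleC_add_right scaleC_scaleC
        scaleR_scaleC)
  show "cinner x y = cnj (cinner y x)"
    unfolding cinner_l2_def by (subst cinner_commute) simp
  show "cinner (x + y) z = cinner x z + cinner y z"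
    unfolding cinner_l2_def coord_simps cinner_add_left
    by (intro infsum_add cinner_summable coord_summable)
  show "cinner (c *\<^sub>C x) y = c * cinner x y"
    unfolding cinner_l2_def coord_simps cinner_scaleC_left
    by (intro infsum_cmult_right cinner_summable coord_summable)
  show "inner x y = Re (cinner x y)"
    unfolding inner_l2_def cinner_l2_def inner_eq_Re_cinner
    by (intro infsum_Re cinner_summable coord_summable)
qed

end


section \<open>The full Fock space and its Hilbert tensor products\<close>

text \<open>
  The free semigroup on \<open>n = CARD('n)\<close> generators is \<^typ>\<open>'n list\<close>, a word being the list of
  its letters.  Since the \<open>e\<^sub>\<alpha>\<close> form an orthonormal basis, the full Fock space is the space of
  square-summable families over words, and its Hilbert tensor product with \<open>K\<close> is the space of
  square-summable \<open>K\<close>-valued families, with \<open>\<phi> \<otimes> k = (\<phi>\<^sub>\<alpha> k)\<^sub>\<alpha>\<close>.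
\<close>

type_synonym 'n fock = "('n list, complex) l2"
type_synonym ('n, 'k) fock_tensor = "('n list, 'k) l2"

definition fock_basis :: "'n list \<Rightarrow> 'n fock" where
  "fock_basis \<alpha> = Abs_l2 (\<lambda>\<beta>. if \<beta> = \<alpha> then 1 else 0)"

definition tensor :: "'n fock \<Rightarrow> 'k::complex_hilbert \<Rightarrow> ('n, 'k) fock_tensor" where
  "tensor \<phi> k = Abs_l2 (\<lambda>\<alpha>. coord \<phi> \<alpha> *\<^sub>C k)"

lemma coord_fock_basis: "coord (fock_basis \<alpha>) \<beta> = (if \<beta> = \<alpha> then 1 else 0)"
proof -
  have "(\<lambda>\<beta>. (cmod (if \<beta> = \<alpha> then 1 else 0))\<^sup>2) summable_on UNIV \<longleftrightarrow>
      (\<lambda>\<beta>. (cmod (if \<beta> = \<alpha> then 1 else 0))\<^sup>2) summable_on {\<alpha>}"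
    by (rule summable_on_cong_neutral) auto
  then show ?thesis
    by (simp add: fock_basis_def Abs_l2_inverse)
qed

lemma coord_tensor: "coord (tensor \<phi> k) \<alpha> = coord \<phi> \<alpha> *\<^sub>C k"
  using summable_on_cmult_left[OF coord_summable[of \<phi>], of "(norm k)\<^sup>2"]
  by (simp add: tensor_def Abs_l2_inverse power_mult_distrib)

lemma cinner_tensor: "cinner (tensor \<phi> k) (tensor \<psi> l) = cinner \<phi> \<psi> * cinner k l"
proof -
  have "cinner (tensor \<phi> k) (tensor \<psi> l)
      = (\<Sum>\<^sub>\<infinity>\<alpha>. cinner (coord \<phi> \<alpha>) (coord \<psi> \<alpha>) * cinner k l)"
    by (simp add: cinner_l2_def coord_tensor cinner_scaleC_left cinner_scaleC_right
        cinner_complex_def mult_ac)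
  also have "\<dots> = cinner \<phi> \<psi> * cinner k l"
    unfolding cinner_l2_def by (intro infsum_cmult_left cinner_summable coord_summable)
  finally show ?thesis .
qed

text \<open>
  For a closed subspace \<open>D\<close>, the Hilbert tensor product of the Fock space with \<open>D\<close>, as a closed
  subspace of its tensor product with the ambient type.  A real span suffices, because complex
  scalars can be absorbed into \<open>\<phi>\<close>.
\<close>

definition fock_tensor_space :: "'k::complex_hilbert set \<Rightarrow> ('n, 'k) fock_tensor set" where
  "fock_tensor_space D = closure (span {tensor \<phi> d | \<phi> d. d \<in> D})"

lemma fock_tensor_space_eq:
  fixes D :: "'k::complex_hilbert set"
  assumes "csubspace D" "closed D"
  shows "(fock_tensor_space D :: ('n, 'k) fock_tensor set) = {x. \<forall>\<alpha>. coord x \<alpha> \<in> D}"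
proof
  let ?T = "{tensor \<phi> d | (\<phi> :: 'n fock) d. d \<in> D}"
  have sub: "subspace D" and sc: "\<And>c x. x \<in> D \<Longrightarrow> c *\<^sub>C x \<in> D"
    using assms(1) by (auto simp: csubspace_def)
  have bl: "bounded_linear (\<lambda>x :: ('n, 'k) fock_tensor. coord x \<alpha>)" for \<alpha>
    by (rule bounded_linear_intro[where K = 1]) (simp_all add: coord_simps norm_coord_le)
  have "closed {x :: ('n, 'k) fock_tensor. coord x \<alpha> \<in> D}" for \<alpha>
    using closed_vimage[OF assms(2) linear_continuous_on[OF bl, of UNIV \<alpha>]]
    by (simp add: vimage_def)
  then have cl: "closed {x :: ('n, 'k) fock_tensor. \<forall>\<alpha>. coord x \<alpha> \<in> D}"
    by (rule closed_Collect_all)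
  have "subspace {x :: ('n, 'k) fock_tensor. \<forall>\<alpha>. coord x \<alpha> \<in> D}"
    using sub by (auto simp: subspace_def coord_simps)
  then have "span ?T \<subseteq> {x. \<forall>\<alpha>. coord x \<alpha> \<in> D}"
    by (intro span_minimal) (auto simp: coord_tensor sc)
  then show "fock_tensor_space D \<subseteq> {x :: ('n, 'k) fock_tensor. \<forall>\<alpha>. coord x \<alpha> \<in> D}"
    unfolding fock_tensor_space_def using cl by (rule closure_minimal)
  show "{x. \<forall>\<alpha>. coord x \<alpha> \<in> D} \<subseteq> (fock_tensor_space D :: ('n, 'k) fock_tensor set)"
  proof
    fix x :: "('n, 'k) fock_tensor"
    assume x: "x \<in> {x. \<forall>\<alpha>. coord x \<alpha> \<in> D}"
    show "x \<in> fock_tensor_space D"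
      unfolding fock_tensor_space_def closure_approachable
    proof (intro allI impI)
      fix e :: real assume "e > 0"
      obtain F where F: "finite F"
        "dist (\<Sum>\<alpha>\<in>F. (norm (coord x \<alpha>))\<^sup>2) (\<Sum>\<^sub>\<infinity>\<alpha>. (norm (coord x \<alpha>))\<^sup>2) \<le> (e / 2)\<^sup>2"
        using infsum_finite_approximation[OF coord_summable, of "(e / 2)\<^sup>2" x] \<open>e > 0\<close> by auto
      define y where "y = (\<Sum>\<alpha>\<in>F. tensor (fock_basis \<alpha>) (coord x \<alpha>))"
      have "coord y \<beta> = (\<Sum>\<alpha>\<in>F. coord (tensor (fock_basis \<alpha>) (coord x \<alpha>)) \<beta>)" for \<beta>
        unfolding y_def by (rule linear_sum[OF bounded_linear.linear[OF bl]])
      then have y: "coord y \<beta> = (if \<beta> \<in> F then coord x \<beta> else 0)" for \<beta>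
        using F(1) by (simp add: coord_tensor coord_fock_basis if_distrib[of "\<lambda>c. c *\<^sub>C _"]
            cong: if_cong)
      have "(norm (y - x))\<^sup>2 = (\<Sum>\<^sub>\<infinity>\<alpha>\<in>UNIV - F. (norm (coord x \<alpha>))\<^sup>2)"
        unfolding norm_l2_square by (rule infsum_cong_neutral) (auto simp: coord_simps y)
      also have "\<dots> = (\<Sum>\<^sub>\<infinity>\<alpha>. (norm (coord x \<alpha>))\<^sup>2) - (\<Sum>\<^sub>\<infinity>\<alpha>\<in>F. (norm (coord x \<alpha>))\<^sup>2)"
        using F(1) by (intro infsum_Diff coord_summable) auto
      also have "\<dots> \<le> (e / 2)\<^sup>2"
        using F by (simp add: dist_real_def)
      finally have "norm (y - x) \<le> e / 2"
        by (rule power2_le_imp_le) (use \<open>e > 0\<close> in simp)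
      moreover have "y \<in> span ?T"
        unfolding y_def using x by (intro span_sum span_base) auto
      ultimately show "\<exists>y\<in>span ?T. dist y x < e"
        using \<open>e > 0\<close> by (intro bexI[of _ y]) (auto simp: dist_norm)
    qed
  qed
qed

text \<open>
  \<open>T \<otimes> I\<close> for a bounded operator \<open>T\<close>; the ampliated space is determined by the type.
\<close>

definition ampliation ::
    "('n fock \<Rightarrow> 'n fock) \<Rightarrow> ('n, 'k::complex_hilbert) fock_tensor \<Rightarrow> ('n, 'k) fock_tensor" where
  "ampliation T = (THE A. bounded_clinear A \<and> (\<forall>\<phi> k. A (tensor \<phi> k) = tensor (T \<phi>) k))"

definition left_creation :: "'n \<Rightarrow> 'n fock \<Rightarrow> 'n fock" where
  "left_creation i \<phi> =
     Abs_l2 (\<lambda>\<beta>. case \<beta> of [] \<Rightarrow> 0 | j # \<alpha> \<Rightarrow> if j = i then coord \<phi> \<alpha> else 0)"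


section \<open>Admissible free holomorphic functions and their universal models\<close>

text \<open>
  A formal power series in the noncommuting indeterminates \<open>Z\<^sub>i\<close> is its family of coefficients.
\<close>

definition nc_one :: "'n list \<Rightarrow> real" where
  "nc_one \<alpha> = (if \<alpha> = [] then 1 else 0)"

definition nc_mult :: "('n list \<Rightarrow> real) \<Rightarrow> ('n list \<Rightarrow> real) \<Rightarrow> 'n list \<Rightarrow> real" where
  "nc_mult f g \<gamma> = (\<Sum>(\<alpha>, \<beta>) | \<alpha> @ \<beta> = \<gamma>. f \<alpha> * g \<beta>)"

definition nc_inverse :: "('n list \<Rightarrow> real) \<Rightarrow> 'n list \<Rightarrow> real" where
  "nc_inverse f = (THE g. nc_mult f g = nc_one \<and> nc_mult g f = nc_one)"

text \<open>The diagonal operator \<open>D\<^sub>i\<close>; it is well defined and bounded if \<open>b\<^sub>\<alpha> / b\<^bsub>i\<alpha>\<^esub>\<close> is bounded.\<close>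

definition weight_op :: "('n list \<Rightarrow> real) \<Rightarrow> 'n \<Rightarrow> 'n fock \<Rightarrow> 'n fock" where
  "weight_op b i \<phi> = Abs_l2 (\<lambda>\<alpha>. sqrt (b \<alpha> / b (i # \<alpha>)) *\<^sub>R coord \<phi> \<alpha>)"

definition universal_model :: "('n list \<Rightarrow> real) \<Rightarrow> 'n \<Rightarrow> 'n fock \<Rightarrow> 'n fock" where
  "universal_model b i = left_creation i \<circ> weight_op b i"

definition word_op :: "('n \<Rightarrow> 'a \<Rightarrow> 'a) \<Rightarrow> 'n list \<Rightarrow> 'a \<Rightarrow> 'a" where
  "word_op X \<alpha> = foldr (\<lambda>i T. X i \<circ> T) \<alpha> id"

definition defect_partial_sum :: "('n::finite list \<Rightarrow> real) \<Rightarrow> nat \<Rightarrow> 'n fock \<Rightarrow> 'n fock" where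
  "defect_partial_sum b k \<phi> =
     (\<Sum>p\<le>k. \<Sum>\<alpha> | length \<alpha> = p. nc_inverse b \<alpha> *\<^sub>R
        word_op (universal_model b) \<alpha> (hilbert_adjoint (word_op (universal_model b) \<alpha>) \<phi>))"

definition admissible :: "('n::finite list \<Rightarrow> real) \<Rightarrow> bool" where
  "admissible b \<longleftrightarrow>
     (\<forall>\<alpha>. b \<alpha> > 0) \<and> b [] = 1 \<and>
     (\<forall>i. bdd_above (range (\<lambda>\<alpha>. b \<alpha> / b (i # \<alpha>)))) \<and>
     limsup (\<lambda>k. ereal ((\<Sum>\<alpha> | length \<alpha> = k. (b \<alpha>)\<^sup>2) powr (1 / (2 * real k)))) < \<infinity> \<and>
     bdd_above (range (\<lambda>k. onorm (defect_partial_sum b k)))"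

end

theory Submission
  imports Defs
begin

text \<open>
  Since the weights are at most 1, the universal model has an explicit isometric dilation. Put
  \<open>\<epsilon>\<^sub>\<gamma> = b\<^sub>\<gamma> - b\<^bsub>tl \<gamma>\<^esub>\<close> (and \<open>\<epsilon> = b\<close> at the empty word). Then \<open>\<Sum>\<^bsub>\<alpha>\<gamma> = \<beta>\<^esub> \<epsilon>\<^sub>\<gamma> = b\<^sub>\<beta>\<close> telescopes, so that
  \<open>C (e\<^sub>\<alpha> \<otimes> e\<^sub>\<gamma> \<otimes> k) = sqrt (\<epsilon>\<^sub>\<gamma> / b\<^bsub>\<alpha>\<gamma>\<^esub>) e\<^bsub>\<alpha>\<gamma>\<^esub> \<otimes> k\<close> defines a coisometry, and
  \<open>C (S\<^sub>i \<otimes> I \<otimes> I) = (W\<^sub>i \<otimes> I) C\<close>. If \<open>M\<close> is invariant under the model, then \<open>N = C\<^sup>-\<^sup>1 M\<close> is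
  invariant under the pure row isometry \<open>(S\<^sub>i \<otimes> I \<otimes> I)\<^sub>i\<close>, whence the Wold decomposition identifies
  \<open>N\<close> with \<open>F\<^sup>2 \<otimes> L\<close> for its wandering subspace \<open>L\<close>. As \<open>N\<close> contains the kernel of \<open>C\<close>, the
  restriction of \<open>C\<close> to \<open>N\<close> is a partial isometry onto \<open>M\<close>.
\<close>

section \<open>Hilbert space geometry\<close>

text \<open>A Cauchy sequence in the image pulls back to one in \<open>S\<close>. The hypothesis is
  confined to \<open>S\<close> so that it fits the Wold map, whose series is controlled only on
  \<open>wandering_fock\<close>.\<close>

lemma complete_isometric_on_image:
  assumes "complete S" and iso: "\<And>x y. x \<in> S \<Longrightarrow> y \<in> S \<Longrightarrow> dist (f x) (f y) = dist x y"
  shows "complete (f ` S)"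
  unfolding complete_def
proof (intro allI impI)
  fix g :: "nat \<Rightarrow> 'b"
  assume g: "(\<forall>n. g n \<in> f ` S) \<and> Cauchy g"
  then have "\<forall>n. \<exists>y. y \<in> S \<and> g n = f y"
    by blast
  from choice[OF this] obtain x where x: "\<And>n. x n \<in> S" "\<And>n. g n = f (x n)"
    by blast
  have "Cauchy x"
    using g by (simp add: Cauchy_def x iso)
  then obtain l where l: "l \<in> S" "x \<longlonglongrightarrow> l"
    using \<open>complete S\<close> x(1) by (meson completeE)
  have "(\<lambda>n. dist (g n) (f l)) \<longlonglongrightarrow> 0"
    using l(2) unfolding x(2) iso[OF x(1) l(1)] by (rule tendsto_dist_iff[THEN iffD1])
  then show "\<exists>l\<in>f ` S. g \<longlonglongrightarrow> l"
    using l(1) tendsto_dist_iff by blast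
qed

lemma minimal_distance_orthogonal:
  fixes w z :: "'a::real_inner"
  assumes "\<And>t. norm w \<le> norm (w - t *\<^sub>R z)"
  shows "inner w z = 0"
proof (cases "z = 0")
  case False
  \<comment> \<open>The minimiser of the quadratic \<open>(norm (w - t *\<^sub>R z))\<^sup>2\<close>
    in \<open>t\<close>.\<close>
  define t where "t = inner w z / inner z z"
  have "(norm w)\<^sup>2 \<le> (norm (w - t *\<^sub>R z))\<^sup>2"
    using assms by (simp add: power_mono)
  also have "\<dots> = (norm w)\<^sup>2 - (inner w z)\<^sup>2 / inner z z"
  proof -
    have "(norm (w - t *\<^sub>R z))\<^sup>2 = (norm w)\<^sup>2 - 2 * t * inner w z + t\<^sup>2 * inner z z"
      unfolding power2_norm_eq_inner
      by (simp add: inner_diff inner_commute algebra_simps power2_eq_square[of t]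
          del: dot_square_norm)
    then show ?thesis
      using False by (simp add: t_def power2_eq_square)
  qed
  finally have "(inner w z)\<^sup>2 / inner z z \<le> 0"
    by simp
  moreover have "inner z z > 0"
    using False by simp
  ultimately show ?thesis
    by (simp add: divide_le_0_iff)
qed simp

text \<open>A minimising sequence for the distance to \<open>x\<close> is Cauchy; its limit realises
  the distance, and minimality forces orthogonality.\<close>

lemma orthogonal_projection_exists:
  fixes S :: "'a::real_inner set"
  assumes S: "subspace S" and "complete S"
  obtains y where "y \<in> S" "\<And>z. z \<in> S \<Longrightarrow> inner (x - y) z = 0"
proof -
  define d where "d = (INF y\<in>S. (norm (x - y))\<^sup>2)"
  have ne: "S \<noteq> {}"
    using subspace_0[OF S] by auto
  have bdd: "bdd_below ((\<lambda>y. (norm (x - y))\<^sup>2) ` S)"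
    by (rule bdd_belowI[of _ 0]) auto
  have d_le: "d \<le> (norm (x - y))\<^sup>2" if "y \<in> S" for y
    unfolding d_def using bdd that by (rule cINF_lower)
  have "\<exists>y\<in>S. (norm (x - y))\<^sup>2 < d + 1 / Suc n" for n
    using cInf_lessD[of "(\<lambda>y. (norm (x - y))\<^sup>2) ` S" "d + 1 / Suc n"] ne by (auto simp: d_def)
  then obtain y where y: "\<And>n. y n \<in> S" "\<And>n. (norm (x - y n))\<^sup>2 < d + 1 / Suc n"
    by metis
  \<comment> \<open>Parallelogram law: the midpoint of \<open>y m\<close> and \<open>y n\<close>
    lies in \<open>S\<close>, so its squared distance to \<open>x\<close> is at least
    \<open>d\<close>.\<close>
  have par: "(norm (y m - y n))\<^sup>2 \<le> 2 / Suc m + 2 / Suc n" for m n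
  proof -
    have "(1/2) *\<^sub>R (y m + y n) \<in> S"
      using y(1) S by (simp add: subspace_add subspace_scale)
    then have "d \<le> (norm (x - (1/2) *\<^sub>R (y m + y n)))\<^sup>2"
      by (rule d_le)
    moreover have "(norm (y m - y n))\<^sup>2 = 2 * (norm (x - y m))\<^sup>2 + 2 * (norm (x - y n))\<^sup>2
        - 4 * (norm (x - (1/2) *\<^sub>R (y m + y n)))\<^sup>2"
      by (simp add: power2_norm_eq_inner inner_diff inner_add inner_commute algebra_simps)
    moreover have "2 / real (Suc k) = 2 * (1 / Suc k)" for k
      by simp
    ultimately show ?thesis
      using y(2)[of m] y(2)[of n] by linarith
  qed
  have "Cauchy y"
  proof (rule metric_CauchyI)
    fix e :: real assume "e > 0"
    \<comment> \<open>A quarter of \<open>e\<^sup>2\<close>, since both terms in \<open>par\<close>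
      are at most \<open>2 / Suc N\<close>.\<close>
    then obtain N where N: "1 / Suc N < e\<^sup>2 / 4"
      using nat_approx_posE[of "e\<^sup>2 / 4"] by auto
    have "dist (y m) (y n) < e" if "m \<ge> N" "n \<ge> N" for m n
    proof -
      have "2 / Suc m \<le> 2 / Suc N" "2 / Suc n \<le> 2 / Suc N"
        using that by (auto intro!: divide_left_mono)
      then have "(norm (y m - y n))\<^sup>2 < e\<^sup>2"
        using par[of m n] N by simp
      then show ?thesis
        using \<open>e > 0\<close> power_less_imp_less_base[of "norm (y m - y n)" 2 e] by (simp add: dist_norm)
    qed
    then show "\<exists>N. \<forall>m\<ge>N. \<forall>n\<ge>N. dist (y m) (y n) < e"
      by blast
  qed
  then obtain l where l: "l \<in> S" "y \<longlonglongrightarrow> l"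
    using \<open>complete S\<close> y(1) by (meson completeE)
  have "(\<lambda>n. (norm (x - y n))\<^sup>2) \<longlonglongrightarrow> (norm (x - l))\<^sup>2"
    by (intro tendsto_intros l)
  moreover have "(\<lambda>n. d + 1 / Suc n) \<longlonglongrightarrow> d + 0"
    using LIMSEQ_inverse_real_of_nat by (intro tendsto_intros) (simp add: inverse_eq_divide)
  ultimately have "(norm (x - l))\<^sup>2 \<le> d + 0"
    by (rule LIMSEQ_le) (use y(2) less_imp_le in blast)
  then have min: "norm (x - l) \<le> norm (x - z)" if "z \<in> S" for z
    using d_le[OF that] by (simp add: power2_le_imp_le)
  show thesis
  proof
    fix z assume "z \<in> S"
    then have "l + t *\<^sub>R z \<in> S" for t
      using l(1) S by (simp add: subspace_add subspace_scale)
    from min[OF this] show "inner (x - l) z = 0"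
      by (intro minimal_distance_orthogonal) (simp add: diff_diff_eq)
  qed (fact l)
qed

text \<open>By Pythagoras, tails of the vector sum are as small as tails of the series of squared
  norms, so the finite partial sums form a Cauchy net.\<close>

lemma orthogonal_family_summable:
  fixes v :: "'i \<Rightarrow> 'a::{real_inner, complete_space}"
  assumes orth: "\<And>i j. i \<noteq> j \<Longrightarrow> inner (v i) (v j) = 0"
    and summ: "(\<lambda>i. (norm (v i))\<^sup>2) summable_on UNIV"
  shows "v summable_on UNIV" and "(norm (infsum v UNIV))\<^sup>2 = (\<Sum>\<^sub>\<infinity>i. (norm (v i))\<^sup>2)"
proof -
  have pyth: "(norm (sum v F))\<^sup>2 = (\<Sum>i\<in>F. (norm (v i))\<^sup>2)" if "finite F" for F
    using that orth by (intro norm_sum_Pythagorean) (auto simp: pairwise_def orthogonal_def)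
  have "\<exists>P. eventually P (finite_subsets_at_top UNIV) \<and>
              (\<forall>F F'. P F \<and> P F' \<longrightarrow> dist (sum v F) (sum v F') < e)" if "e > 0" for e
  proof -
    obtain F0 where F0: "finite F0"
      "dist (\<Sum>i\<in>F0. (norm (v i))\<^sup>2) (\<Sum>\<^sub>\<infinity>i. (norm (v i))\<^sup>2) \<le> (e / 3)\<^sup>2"
      using infsum_finite_approximation[OF summ, of "(e / 3)\<^sup>2"] \<open>e > 0\<close> by auto
    \<comment> \<open>Enlarging \<open>F0\<close> adds at most the tail
      \<open>(e / 3)\<^sup>2\<close> to the squared norm; two enlargements are then within
      \<open>2 * e / 3\<close> of each other.\<close>
    have *: "dist (sum v F) (sum v F0) \<le> e / 3" if "finite F \<and> F0 \<subseteq> F" for F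
    proof -
      have "sum v (F - F0) = sum v F - sum v F0"
        using that by (simp add: sum_diff)
      then have "(norm (sum v F - sum v F0))\<^sup>2 = (\<Sum>i\<in>F. (norm (v i))\<^sup>2) - (\<Sum>i\<in>F0. (norm (v i))\<^sup>2)"
        using that pyth[of "F - F0"] by (simp add: sum_diff)
      also have "\<dots> \<le> (\<Sum>\<^sub>\<infinity>i. (norm (v i))\<^sup>2) - (\<Sum>i\<in>F0. (norm (v i))\<^sup>2)"
        using that by (intro diff_right_mono finite_sum_le_infsum summ) auto
      also have "\<dots> \<le> (e / 3)\<^sup>2"
        using F0(2) by (simp add: dist_real_def)
      finally show ?thesis
        unfolding dist_norm by (rule power2_le_imp_le) (use \<open>e > 0\<close> in simp)
    qed
    have "dist (sum v F) (sum v F') < e" if "finite F \<and> F0 \<subseteq> F" "finite F' \<and> F0 \<subseteq> F'" for F F'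
      using *[OF that(1)] *[OF that(2)] \<open>e > 0\<close> dist_triangle2[of "sum v F" "sum v F'" "sum v F0"]
      by linarith
    moreover have "eventually (\<lambda>F. finite F \<and> F0 \<subseteq> F) (finite_subsets_at_top UNIV)"
      using F0(1) by (auto simp: eventually_finite_subsets_at_top)
    ultimately show ?thesis
      by blast
  qed
  then have "cauchy_filter (filtermap (sum v) (finite_subsets_at_top UNIV))"
    by (simp add: cauchy_filter_metric_filtermap)
  moreover have "complete (UNIV :: 'a set)"
    by (meson Cauchy_convergent UNIV_I complete_def convergent_def)
  ultimately obtain l where "(sum v \<longlongrightarrow> l) (finite_subsets_at_top UNIV)"
    using complete_uniform[where S = UNIV] by (force simp add: filterlim_def)
  then show sv: "v summable_on UNIV"
    by (auto simp: summable_on_def has_sum_def)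
  have "((\<lambda>F. (norm (sum v F))\<^sup>2) \<longlongrightarrow> (norm (infsum v UNIV))\<^sup>2) (finite_subsets_at_top UNIV)"
    by (intro tendsto_intros infsum_tendsto sv)
  moreover have "((\<lambda>F. (norm (sum v F))\<^sup>2) \<longlongrightarrow> (\<Sum>\<^sub>\<infinity>i. (norm (v i))\<^sup>2)) (finite_subsets_at_top UNIV)"
    using infsum_tendsto[OF summ]
    by (rule Lim_transform_eventually)
      (auto simp: pyth intro!: eventually_finite_subsets_at_top_weakI)
  ultimately show "(norm (infsum v UNIV))\<^sup>2 = (\<Sum>\<^sub>\<infinity>i. (norm (v i))\<^sup>2)"
    by (rule tendsto_unique[rotated]) simp
qed

text \<open>Consequently real orthogonality to a complex subspace is already complex
  orthogonality.\<close>

lemma cinner_eq_inner: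
  "cinner x y = Complex (inner x y) (inner x (\<i> *\<^sub>C y))" for x y :: "'a::complex_hilbert"
  by (simp add: complex_eq_iff inner_eq_Re_cinner cinner_scaleC_right)

section \<open>Bounded complex-linear maps\<close>

lemma bounded_clinear_linear: "bounded_clinear T \<Longrightarrow> bounded_linear T"
  and bounded_clinear_scaleC: "bounded_clinear T \<Longrightarrow> T (c *\<^sub>C x) = c *\<^sub>C T x"
  by (auto simp: bounded_clinear_def)

lemma bounded_clinear_compose:
  "bounded_clinear S \<Longrightarrow> bounded_clinear T \<Longrightarrow> bounded_clinear (S \<circ> T)"
  by (auto simp: bounded_clinear_def o_def intro: bounded_linear_compose)

lemma bounded_linear_scaleC: "bounded_linear (\<lambda>x :: 'a::complex_hilbert. c *\<^sub>C x)"
  by (rule bounded_linear_intro[where K = "cmod c"])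
    (simp_all add: scaleC_add_right scaleR_scaleC scaleC_scaleC mult.commute)

section \<open>Pure row isometries and their invariant subspaces\<close>

lemma word_op_Nil [simp]: "word_op X [] = id"
  and word_op_Cons [simp]: "word_op X (i # \<alpha>) = X i \<circ> word_op X \<alpha>"
  by (simp_all add: word_op_def)

text \<open>
  Purity, i.e. \<open>\<Inter>\<^sub>k \<Sum>\<^bsub>|\<alpha>| = k\<^esub> V\<^sub>\<alpha> E = 0\<close>, is stated coinductively: a set whose elements all split
  into translates of its own elements lies in this intersection.
\<close>

locale pure_row_isometry =
  fixes V :: "'n::finite \<Rightarrow> 'e::complex_hilbert \<Rightarrow> 'e"
  assumes bounded_clinear_V: "bounded_clinear (V i)"
    and inner_V: "inner (V i x) (V j y) = (if i = j then inner x y else 0)"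
    and pure: "(\<And>x. x \<in> X \<Longrightarrow> \<exists>y. (\<forall>i. y i \<in> X) \<and> x = (\<Sum>i\<in>UNIV. V i (y i))) \<Longrightarrow> X \<subseteq> {0}"
begin

lemma bounded_clinear_word: "bounded_clinear (word_op V \<alpha>)"
proof (induction \<alpha>)
  case Nil
  then show ?case
    using bounded_linear_ident by (simp add: bounded_clinear_def id_def)
next
  case (Cons i \<alpha>)
  then show ?case
    using bounded_clinear_compose[OF bounded_clinear_V] by (simp only: word_op_Cons)
qed

lemma inner_word: "inner (word_op V \<alpha> x) (word_op V \<alpha> y) = inner x y"
  by (induction \<alpha>) (simp_all add: inner_V)

lemma norm_word: "norm (word_op V \<alpha> x) = norm x"
  by (simp add: norm_eq_sqrt_inner inner_word)

end

section \<open>The Wold decomposition of an invariant subspace\<close>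

locale invariant_subspace = pure_row_isometry V
  for V :: "'n::finite \<Rightarrow> 'e::complex_hilbert \<Rightarrow> 'e" +
  fixes N :: "'e set"
  assumes csubspace_N: "csubspace N" and closed_N: "closed N"
    and invariant: "x \<in> N \<Longrightarrow> V i x \<in> N"
begin

lemma subspace_N: "subspace N"
  using csubspace_N by (simp add: csubspace_def)

lemma complete_N: "complete N"
  using closed_N by (simp add: complete_eq_closed)

lemma word_invariant: "x \<in> N \<Longrightarrow> word_op V \<alpha> x \<in> N"
  by (induction \<alpha>) (auto intro: invariant)

text \<open>The orthogonal complement in \<open>N\<close> of the sum of the images of
  \<open>N\<close> under the \<open>V i\<close>. The real inner product suffices because
  \<open>N\<close> and the \<open>V i\<close> are complex.\<close>

definition wandering :: "'e set" where
  "wandering = {x \<in> N. \<forall>i. \<forall>y\<in>N. inner x (V i y) = 0}"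

text \<open>Orthogonality to the images of both \<open>y\<close> and \<open>\<i> *\<^sub>C y\<close>
  annihilates the complex inner product, and this survives complex multiples.\<close>

lemma csubspace_wandering: "csubspace wandering"
proof -
  have "inner (c *\<^sub>C x) (V i y) = 0" if x: "\<forall>y\<in>N. inner x (V i y) = 0" and "y \<in> N" for c x i y
  proof -
    have "\<i> *\<^sub>C y \<in> N"
      using \<open>y \<in> N\<close> csubspace_N by (simp add: csubspace_def)
    then have "cinner x (V i y) = 0"
      using x \<open>y \<in> N\<close> bounded_clinear_scaleC[OF bounded_clinear_V, of i \<i> y]
      by (metis cinner_eq_inner complex_eq_iff complex.sel zero_complex.sel)
    then show ?thesis
      by (simp add: inner_eq_Re_cinner cinner_scaleC_left)
  qed
  then show ?thesis
    using csubspace_N by (auto simp: csubspace_def wandering_def subspace_def inner_add_left)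
qed

lemma closed_wandering: "closed wandering"
proof -
  have "wandering = N \<inter> {x. \<forall>i. \<forall>y\<in>N. inner x (V i y) = 0}"
    by (auto simp: wandering_def)
  moreover have "closed {x. \<forall>i. \<forall>y\<in>N. inner x (V i y) = 0}"
    unfolding Ball_def
    by (intro closed_Collect_all closed_Collect_imp open_Collect_const closed_Collect_eq
        continuous_intros)
  ultimately show ?thesis
    using closed_N by auto
qed

text \<open>The ranges of the \<open>V i\<close> are pairwise orthogonal, so subtracting the
  projections onto each image of \<open>N\<close> separately leaves a vector orthogonal to all of
  them.\<close>

lemma wandering_decomposition:
  assumes "x \<in> N"
  obtains y where "\<And>i. y i \<in> N" "x - (\<Sum>i\<in>UNIV. V i (y i)) \<in> wandering"
proof -
  have lin: "linear (V i)" for i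
    by (rule bounded_linear.linear[OF bounded_clinear_linear[OF bounded_clinear_V]])
  have "\<exists>y\<in>N. \<forall>z\<in>N. inner (x - V i y) (V i z) = 0" for i
  proof -
    have "complete (V i ` N)"
      by (rule complete_isometric_on_image[OF complete_N])
        (simp add: dist_norm norm_eq_sqrt_inner inner_V linear_diff[OF lin, symmetric])
    moreover have "subspace (V i ` N)"
      by (rule linear_subspace_image[OF lin subspace_N])
    ultimately obtain w where "w \<in> V i ` N" "\<And>z. z \<in> V i ` N \<Longrightarrow> inner (x - w) z = 0"
      using orthogonal_projection_exists[of "V i ` N" x] by metis
    then show ?thesis
      by auto
  qed
  then have "\<forall>i. \<exists>y. y \<in> N \<and> (\<forall>z\<in>N. inner (x - V i y) (V i z) = 0)"
    by blast
  from choice[OF this] obtain y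
    where y: "\<And>i. y i \<in> N" "\<And>i z. z \<in> N \<Longrightarrow> inner (x - V i (y i)) (V i z) = 0"
    by blast
  have "x - (\<Sum>i\<in>UNIV. V i (y i)) \<in> N"
    using assms y(1) subspace_N by (intro subspace_diff subspace_sum invariant)
  moreover have "inner (x - (\<Sum>i\<in>UNIV. V i (y i))) (V j z) = 0" if "z \<in> N" for j z
    using y(2)[OF that, of j] by (simp add: inner_diff_left inner_sum_left inner_V)
  ultimately have "x - (\<Sum>i\<in>UNIV. V i (y i)) \<in> wandering"
    by (simp add: wandering_def)
  from that[of y, OF y(1) this] show thesis .
qed

text \<open>Common leading letters cancel since \<open>V i\<close> is isometric, and different ones
  give orthogonal ranges. Once one word is exhausted, a wandering vector meets an element of some
  \<open>V i\<close> image of \<open>N\<close>.\<close>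

lemma wandering_orthogonal:
  assumes "x \<in> wandering" "y \<in> wandering" "\<alpha> \<noteq> \<beta>"
  shows "inner (word_op V \<alpha> x) (word_op V \<beta> y) = 0"
  using assms(3)
proof (induction \<alpha> arbitrary: \<beta>)
  case Nil
  then show ?case
    using assms word_invariant by (cases \<beta>) (auto simp: wandering_def)
next
  case step: (Cons i \<alpha>)
  show ?case
  proof (cases \<beta>)
    case Nil
    have "inner y (V i (word_op V \<alpha> x)) = 0"
      using assms word_invariant by (simp add: wandering_def)
    then show ?thesis
      by (simp add: Nil inner_commute)
  next
    case (Cons j \<beta>')
    then show ?thesis
      using step.IH[of \<beta>'] step.prems by (simp add: inner_V)
  qed
qed

text \<open>The unitary of the Wold decomposition, sending
  \<open>tensor (fock_basis \<alpha>) l\<close> to \<open>word_op V \<alpha> l\<close>. It is meant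
  for \<open>wandering_fock\<close>, where the series converges; \<open>infsum\<close> is 0 on
  non-summable families.\<close>

definition wold :: "('n, 'e) fock_tensor \<Rightarrow> 'e" where
  "wold y = (\<Sum>\<^sub>\<infinity>\<alpha>. word_op V \<alpha> (coord y \<alpha>))"

abbreviation "wandering_fock \<equiv> fock_tensor_space wandering :: ('n, 'e) fock_tensor set"

lemmas wandering_fock_eq = fock_tensor_space_eq[OF csubspace_wandering closed_wandering, where ?'n = 'n]

lemma wold_summable:
  assumes "y \<in> wandering_fock"
  shows "(\<lambda>\<alpha>. word_op V \<alpha> (coord y \<alpha>)) summable_on UNIV"
  by (rule orthogonal_family_summable)
    (use assms coord_summable[of y] in \<open>auto simp: wandering_fock_eq wandering_orthogonal norm_word\<close>)

lemma norm_wold: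
  assumes "y \<in> wandering_fock"
  shows "norm (wold y) = norm y"
proof -
  have "(norm (wold y))\<^sup>2 = (norm y)\<^sup>2"
    unfolding wold_def norm_l2_square using assms coord_summable[of y]
    by (subst orthogonal_family_summable(2)) (auto simp: wandering_fock_eq wandering_orthogonal norm_word)
  then show ?thesis
    by simp
qed

lemma wold_add: "x \<in> wandering_fock \<Longrightarrow> y \<in> wandering_fock \<Longrightarrow> wold (x + y) = wold x + wold y"
  unfolding wold_def
  by (simp add: coord_add infsum_add wold_summable
      linear_add[OF bounded_linear.linear[OF bounded_clinear_linear[OF bounded_clinear_word]]])

lemma wold_scaleC: "y \<in> wandering_fock \<Longrightarrow> wold (c *\<^sub>C y) = c *\<^sub>C wold y"
  unfolding wold_def
  using infsumI[OF has_sum_bounded_linear[OF bounded_linear_scaleC has_sum_infsum[OF wold_summable]]]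
  by (simp add: coord_scaleC bounded_clinear_scaleC[OF bounded_clinear_word])

lemma csubspace_wandering_fock: "csubspace wandering_fock"
  using csubspace_wandering by (auto simp: wandering_fock_eq csubspace_def subspace_def coord_simps)

lemma subspace_wandering_fock: "subspace wandering_fock"
  using csubspace_wandering_fock by (simp add: csubspace_def)

lemma complete_wandering_fock: "complete wandering_fock"
  by (simp add: complete_eq_closed fock_tensor_space_def)

lemma wold_diff: "x \<in> wandering_fock \<Longrightarrow> y \<in> wandering_fock \<Longrightarrow> wold (x - y) = wold x - wold y"
  using wold_add[of "x - y" y] subspace_diff[OF subspace_wandering_fock] by simp

text \<open>This puts every translate of a wandering vector into the range of the Wold map.\<close>

lemma wold_tensor:
  assumes "x \<in> wandering"
  shows "tensor (fock_basis \<alpha>) x \<in> wandering_fock" and "wold (tensor (fock_basis \<alpha>) x) = word_op V \<alpha> x"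
proof -
  have "0 \<in> wandering"
    using csubspace_wandering by (simp add: csubspace_def subspace_def)
  then show "tensor (fock_basis \<alpha>) x \<in> wandering_fock"
    using assms by (auto simp: wandering_fock_eq coord_tensor coord_fock_basis)
  have "wold (tensor (fock_basis \<alpha>) x) = (\<Sum>\<^sub>\<infinity>\<beta>\<in>{\<alpha>}. word_op V \<alpha> x)"
    unfolding wold_def
    by (rule infsum_cong_neutral) (auto simp: coord_tensor coord_fock_basis
      linear_0[OF bounded_linear.linear[OF bounded_clinear_linear[OF bounded_clinear_word]]])
  then show "wold (tensor (fock_basis \<alpha>) x) = word_op V \<alpha> x"
    by simp
qed

text \<open>The vectors of \<open>N\<close> orthogonal to all translates of wandering vectors form a
  set to which purity applies.\<close>

lemma orthogonal_to_translates_eq_0: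
  assumes "x \<in> N" "\<And>\<alpha> l. l \<in> wandering \<Longrightarrow> inner x (word_op V \<alpha> l) = 0"
  shows "x = 0"
proof -
  define X where "X = {x \<in> N. \<forall>\<alpha>. \<forall>l\<in>wandering. inner x (word_op V \<alpha> l) = 0}"
  have "X \<subseteq> {0}"
  proof (rule pure)
    fix x assume x: "x \<in> X"
    then obtain y where y: "\<And>i. y i \<in> N" "x - (\<Sum>i\<in>UNIV. V i (y i)) \<in> wandering"
      using wandering_decomposition[of x] by (auto simp: X_def)
    define l where "l = x - (\<Sum>i\<in>UNIV. V i (y i))"
    have l: "l \<in> wandering"
      using y(2) by (simp add: l_def)
    \<comment> \<open>The case of the empty word. As \<open>l\<close> is also orthogonal to the sum
      of the \<open>V i (y i)\<close>, it must vanish.\<close>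
    have "inner x l = 0"
      using x l by (auto simp: X_def dest: spec[of _ "[]"])
    moreover have "inner l (\<Sum>i\<in>UNIV. V i (y i)) = 0"
      using l y(1) by (simp add: inner_sum_right wandering_def)
    ultimately have "inner l l = 0"
      by (simp add: l_def inner_diff_left inner_diff_right inner_commute)
    then have x_eq: "x = (\<Sum>i\<in>UNIV. V i (y i))"
      by (simp add: l_def)
    \<comment> \<open>Testing \<open>y j\<close> against the word \<open>\<alpha>\<close> is testing
      \<open>x\<close> against \<open>j # \<alpha>\<close>, so \<open>y j\<close> stays in
      \<open>X\<close>.\<close>
    have "inner (y j) (word_op V \<alpha> l) = 0" if "l \<in> wandering" for j \<alpha> l
    proof -
      have "inner (y j) (word_op V \<alpha> l) = inner x (word_op V (j # \<alpha>) l)"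
        by (simp add: x_eq inner_sum_left inner_V)
      then show ?thesis
        using x that unfolding X_def by (metis (mono_tags, lifting) mem_Collect_eq)
    qed
    then show "\<exists>y. (\<forall>i. y i \<in> X) \<and> x = (\<Sum>i\<in>UNIV. V i (y i))"
      using x_eq y(1) by (auto simp: X_def intro!: exI[of _ y])
  qed
  then show ?thesis
    using assms by (auto simp: X_def)
qed

text \<open>The range lies in \<open>N\<close> because \<open>N\<close> is closed. Being complete,
  it admits projections; the remainder of a vector of \<open>N\<close> is orthogonal to all
  translates and hence 0.\<close>

lemma wold_image: "wold ` wandering_fock = N"
proof
  show sub: "wold ` wandering_fock \<subseteq> N"
  proof
    fix x assume "x \<in> wold ` wandering_fock"
    then obtain y where y: "y \<in> wandering_fock" "x = wold y" by auto
    have "coord y \<alpha> \<in> wandering" for \<alpha>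
      using y(1) by (simp add: wandering_fock_eq)
    then have "coord y \<alpha> \<in> N" for \<alpha>
      by (simp add: wandering_def)
    then have "(\<Sum>\<alpha>\<in>A. word_op V \<alpha> (coord y \<alpha>)) \<in> N" for A
      by (intro subspace_sum[OF subspace_N] word_invariant)
    then have "\<forall>\<^sub>F A in finite_subsets_at_top UNIV. (\<Sum>\<alpha>\<in>A. word_op V \<alpha> (coord y \<alpha>)) \<in> N"
      by (rule always_eventually[OF allI])
    from Lim_in_closed_set[OF closed_N this _ infsum_tendsto[OF wold_summable[OF y(1)]]]
    show "x \<in> N"
      unfolding y(2) wold_def by simp
  qed
  show "N \<subseteq> wold ` wandering_fock"
  proof
    fix x assume "x \<in> N"
    have "subspace (wold ` wandering_fock)"
      unfolding subspace_def
    proof (intro conjI ballI allI)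
      show "0 \<in> wold ` wandering_fock"
        using subspace_0[OF subspace_wandering_fock] norm_wold[of 0] by (auto intro!: image_eqI[of _ _ 0])
      fix u v assume "u \<in> wold ` wandering_fock" "v \<in> wold ` wandering_fock"
      then obtain x y where "x \<in> wandering_fock" "y \<in> wandering_fock" "u = wold x" "v = wold y"
        by auto
      then show "u + v \<in> wold ` wandering_fock"
        using subspace_add[OF subspace_wandering_fock, of x y] by (auto simp: wold_add intro!: image_eqI[of _ _ "x + y"])
    next
      fix c u assume "u \<in> wold ` wandering_fock"
      then obtain x where "x \<in> wandering_fock" "u = wold x"
        by auto
      then show "c *\<^sub>R u \<in> wold ` wandering_fock"
        using csubspace_wandering_fock unfolding scaleR_scaleC csubspace_def
        by (intro image_eqI[of _ _ "complex_of_real c *\<^sub>C x"]) (auto simp: wold_scaleC)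
    qed
    moreover have "complete (wold ` wandering_fock)"
      by (rule complete_isometric_on_image[OF complete_wandering_fock])
        (simp add: dist_norm wold_diff[symmetric] norm_wold subspace_diff[OF subspace_wandering_fock])
    ultimately obtain y where y: "y \<in> wold ` wandering_fock" "\<And>z. z \<in> wold ` wandering_fock \<Longrightarrow> inner (x - y) z = 0"
      using orthogonal_projection_exists[of "wold ` wandering_fock" x] by metis
    have "x - y = 0"
    proof (rule orthogonal_to_translates_eq_0)
      show "x - y \<in> N"
        using \<open>x \<in> N\<close> y(1) sub subspace_diff[OF subspace_N] by blast
      show "inner (x - y) (word_op V \<alpha> l) = 0" if "l \<in> wandering" for \<alpha> l
        using y(2)[OF imageI[OF wold_tensor(1)[OF that]]] by (simp add: wold_tensor(2)[OF that])
    qed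
    then show "x \<in> wold ` wandering_fock"
      using y(1) by simp
  qed
qed

end

section \<open>Weighted composition operators\<close>

text \<open>A bound on finite sums of squares yields square-summability, without which
  \<open>Abs_l2\<close> is unspecified, and the norm estimate at once.\<close>

lemma l2_bounded:
  fixes f :: "'i \<Rightarrow> 'k::complex_hilbert"
  assumes "\<And>A. finite A \<Longrightarrow> (\<Sum>i\<in>A. (norm (f i))\<^sup>2) \<le> C\<^sup>2" and "C \<ge> 0"
  shows "coord (Abs_l2 f) i = f i" and "norm (Abs_l2 f) \<le> C"
proof -
  have summ: "(\<lambda>i. (norm (f i))\<^sup>2) summable_on UNIV"
    by (rule nonneg_bdd_above_summable_on) (use assms(1) in \<open>auto intro!: bdd_aboveI[of _ "C\<^sup>2"]\<close>)
  then have coord: "coord (Abs_l2 f) = f"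
    by (simp add: Abs_l2_inverse)
  then show "coord (Abs_l2 f) i = f i"
    by simp
  have "(norm (Abs_l2 f))\<^sup>2 \<le> C\<^sup>2"
    unfolding norm_l2_square coord by (rule infsum_le_finite_sums[OF summ assms(1)])
  then show "norm (Abs_l2 f) \<le> C"
    using assms(2) by (rule power2_le_imp_le)
qed

lemma norm_weighted_sum_le:
  fixes x :: "'i \<Rightarrow> 'a::real_normed_vector"
  shows "(norm (\<Sum>i\<in>A. c i *\<^sub>R x i))\<^sup>2 \<le> (\<Sum>i\<in>A. (c i)\<^sup>2) * (\<Sum>i\<in>A. (norm (x i))\<^sup>2)"
proof -
  have "norm (\<Sum>i\<in>A. c i *\<^sub>R x i) \<le> (\<Sum>i\<in>A. \<bar>c i\<bar> * norm (x i))"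
    by (rule sum_norm_le) simp
  then have "(norm (\<Sum>i\<in>A. c i *\<^sub>R x i))\<^sup>2 \<le> (\<Sum>i\<in>A. \<bar>c i\<bar> * norm (x i))\<^sup>2"
    by (rule power_mono) simp
  also have "\<dots> \<le> (\<Sum>i\<in>A. \<bar>c i\<bar>\<^sup>2) * (\<Sum>i\<in>A. (norm (x i))\<^sup>2)"
    by (rule Cauchy_Schwarz_ineq_sum)
  finally show ?thesis
    by simp
qed

text \<open>
  \<open>pullback\<close> and \<open>pushforward\<close> are mutually adjoint. The sum in the latter is only meaningful for
  finite fibres.
\<close>

definition pullback :: "('i \<Rightarrow> real) \<Rightarrow> ('i \<Rightarrow> 'j) \<Rightarrow> ('j, 'k::complex_hilbert) l2 \<Rightarrow> ('i, 'k) l2" where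
  "pullback c \<tau> x = Abs_l2 (\<lambda>i. c i *\<^sub>R coord x (\<tau> i))"

definition pushforward :: "('i \<Rightarrow> real) \<Rightarrow> ('i \<Rightarrow> 'j) \<Rightarrow> ('i, 'k::complex_hilbert) l2 \<Rightarrow> ('j, 'k) l2" where
  "pushforward c \<tau> y = Abs_l2 (\<lambda>j. \<Sum>i | \<tau> i = j. c i *\<^sub>R coord y i)"

text \<open>One setting for the left creation operators, the universal model, the dilation and the
  coisometry: fibrewise square sums at most 1 make both operators contractions.\<close>

locale contractive_weights =
  fixes c :: "'i \<Rightarrow> real" and \<tau> :: "'i \<Rightarrow> 'j"
  assumes finite_fibre: "finite {i. \<tau> i = j}"
    and sum_fibre_le: "(\<Sum>i | \<tau> i = j. (c i)\<^sup>2) \<le> 1"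
begin

text \<open>Grouped by fibres, each coordinate of \<open>x\<close> is counted with total weight at
  most 1.\<close>

lemma pullback_sum_le:
  assumes "finite A"
  shows "(\<Sum>i\<in>A. (norm (c i *\<^sub>R coord x (\<tau> i)))\<^sup>2) \<le> (norm x)\<^sup>2"
proof -
  have "(\<Sum>i\<in>A. (norm (c i *\<^sub>R coord x (\<tau> i)))\<^sup>2)
      = (\<Sum>j\<in>\<tau> ` A. \<Sum>i | i \<in> A \<and> \<tau> i = j. (norm (c i *\<^sub>R coord x (\<tau> i)))\<^sup>2)"
    using assms by (rule sum.image_gen)
  also have "\<dots> \<le> (\<Sum>j\<in>\<tau> ` A. (norm (coord x j))\<^sup>2)"
  proof (rule sum_mono)
    fix j
    have "(\<Sum>i | i \<in> A \<and> \<tau> i = j. (norm (c i *\<^sub>R coord x (\<tau> i)))\<^sup>2)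
        = (\<Sum>i | i \<in> A \<and> \<tau> i = j. (c i)\<^sup>2) * (norm (coord x j))\<^sup>2"
      unfolding sum_distrib_right by (rule sum.cong) (auto simp: power_mult_distrib)
    also have "\<dots> \<le> (\<Sum>i | \<tau> i = j. (c i)\<^sup>2) * (norm (coord x j))\<^sup>2"
      by (intro mult_right_mono sum_mono2 finite_fibre) auto
    also have "\<dots> \<le> (norm (coord x j))\<^sup>2"
      using mult_right_mono[OF sum_fibre_le] by simp
    finally show "(\<Sum>i | i \<in> A \<and> \<tau> i = j. (norm (c i *\<^sub>R coord x (\<tau> i)))\<^sup>2) \<le> (norm (coord x j))\<^sup>2" .
  qed
  also have "\<dots> \<le> (norm x)\<^sup>2"
    using assms by (intro sum_coord_le_norm) simp
  finally show ?thesis .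
qed

lemma coord_pullback: "coord (pullback c \<tau> x) i = c i *\<^sub>R coord x (\<tau> i)"
  and norm_pullback_le: "norm (pullback c \<tau> x) \<le> norm x"
  unfolding pullback_def by (rule l2_bounded[OF pullback_sum_le], simp_all)+

text \<open>Cauchy-Schwarz on each fibre; the fibres are disjoint, so no coordinate of
  \<open>y\<close> is counted twice.\<close>

lemma pushforward_sum_le:
  assumes "finite A"
  shows "(\<Sum>j\<in>A. (norm (\<Sum>i | \<tau> i = j. c i *\<^sub>R coord y i))\<^sup>2) \<le> (norm y)\<^sup>2"
proof -
  have "(\<Sum>j\<in>A. (norm (\<Sum>i | \<tau> i = j. c i *\<^sub>R coord y i))\<^sup>2)
      \<le> (\<Sum>j\<in>A. \<Sum>i | \<tau> i = j. (norm (coord y i))\<^sup>2)"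
  proof (rule sum_mono)
    fix j
    have "(norm (\<Sum>i | \<tau> i = j. c i *\<^sub>R coord y i))\<^sup>2
        \<le> (\<Sum>i | \<tau> i = j. (c i)\<^sup>2) * (\<Sum>i | \<tau> i = j. (norm (coord y i))\<^sup>2)"
      by (rule norm_weighted_sum_le)
    also have "\<dots> \<le> 1 * (\<Sum>i | \<tau> i = j. (norm (coord y i))\<^sup>2)"
      by (intro mult_right_mono sum_fibre_le sum_nonneg) simp
    finally show "(norm (\<Sum>i | \<tau> i = j. c i *\<^sub>R coord y i))\<^sup>2
        \<le> (\<Sum>i | \<tau> i = j. (norm (coord y i))\<^sup>2)"
      by simp
  qed
  also have "\<dots> = (\<Sum>i\<in>(\<Union>j\<in>A. {i. \<tau> i = j}). (norm (coord y i))\<^sup>2)"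
    using assms finite_fibre by (intro sum.UNION_disjoint[symmetric]) auto
  also have "\<dots> \<le> (norm y)\<^sup>2"
    using assms finite_fibre by (intro sum_coord_le_norm) simp
  finally show ?thesis .
qed

lemma coord_pushforward: "coord (pushforward c \<tau> y) j = (\<Sum>i | \<tau> i = j. c i *\<^sub>R coord y i)"
  and norm_pushforward_le: "norm (pushforward c \<tau> y) \<le> norm y"
  unfolding pushforward_def by (rule l2_bounded[OF pushforward_sum_le], simp_all)+

lemma bounded_clinear_pullback: "bounded_clinear (pullback c \<tau>)"
proof -
  have "bounded_linear (pullback c \<tau>)"
    by (rule bounded_linear_intro[where K = 1])
      (auto intro!: l2_eqI simp: coord_pullback coord_simps scaleR_add_right norm_pullback_le)
  then show ?thesis
    by (auto intro!: l2_eqI simp: bounded_clinear_def coord_pullback coord_simps scaleR_scaleC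
        scaleC_scaleC mult.commute)
qed

lemma bounded_clinear_pushforward:
  "bounded_clinear (pushforward c \<tau> :: ('i, 'k::complex_hilbert) l2 \<Rightarrow> _)"
proof -
  have "bounded_linear (pushforward c \<tau> :: ('i, 'k) l2 \<Rightarrow> _)"
    by (rule bounded_linear_intro[where K = 1])
      (auto intro!: l2_eqI simp: coord_pushforward coord_simps scaleR_add_right sum.distrib
        scaleR_sum_right mult.commute norm_pushforward_le)
  moreover have "pushforward c \<tau> (a *\<^sub>C y) = a *\<^sub>C pushforward c \<tau> y" for a and y :: "('i, 'k) l2"
  proof (rule l2_eqI)
    fix j
    have "coord (pushforward c \<tau> (a *\<^sub>C y)) j = (\<Sum>i | \<tau> i = j. a *\<^sub>C (c i *\<^sub>R coord y i))"
      by (simp add: coord_pushforward coord_scaleC scaleR_scaleC scaleC_scaleC mult.commute)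
    also have "\<dots> = coord (a *\<^sub>C pushforward c \<tau> y) j"
      unfolding coord_pushforward coord_scaleC
      by (rule linear_sum[OF bounded_linear.linear[OF bounded_linear_scaleC], symmetric])
    finally show "coord (pushforward c \<tau> (a *\<^sub>C y)) j = coord (a *\<^sub>C pushforward c \<tau> y) j" .
  qed
  ultimately show ?thesis
    by (simp add: bounded_clinear_def)
qed

text \<open>With unit fibre sums the pushforward is a coisometry, its adjoint being a right
  inverse.\<close>

lemma pushforward_pullback:
  assumes "\<And>j. (\<Sum>i | \<tau> i = j. (c i)\<^sup>2) = 1"
  shows "pushforward c \<tau> (pullback c \<tau> x) = x"
proof (rule l2_eqI)
  fix j
  have "coord (pushforward c \<tau> (pullback c \<tau> x)) j = (\<Sum>i | \<tau> i = j. (c i)\<^sup>2) *\<^sub>R coord x j"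
    unfolding coord_pushforward coord_pullback scaleR_sum_left
    by (rule sum.cong) (auto simp: power2_eq_square)
  then show "coord (pushforward c \<tau> (pullback c \<tau> x)) j = coord x j"
    by (simp add: assms)
qed

end

text \<open>Elementary tensors span a dense subspace, by \<open>fock_tensor_space_eq\<close> for the
  full space. This is the uniqueness behind \<open>ampliation\<close>.\<close>

lemma bounded_clinear_eq_on_tensors:
  fixes A B :: "('n, 'k::complex_hilbert) fock_tensor \<Rightarrow> 'e::complex_hilbert"
  assumes "bounded_clinear A" "bounded_clinear B" and eq: "\<And>\<phi> k. A (tensor \<phi> k) = B (tensor \<phi> k)"
  shows "A = B"
proof
  fix x :: "('n, 'k) fock_tensor"
  have lin: "bounded_linear (\<lambda>x. A x - B x)"
    using assms by (intro bounded_linear_sub bounded_clinear_linear)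
  have "(fock_tensor_space UNIV :: ('n, 'k) fock_tensor set) = UNIV"
    by (subst fock_tensor_space_eq) (auto simp: csubspace_def)
  then have x: "x \<in> closure (span {tensor \<phi> d | (\<phi> :: 'n fock) d. d \<in> UNIV})"
    by (simp add: fock_tensor_space_def)
  have "A x - B x = 0"
  proof (rule continuous_constant_on_closure[OF _ _ x])
    show "continuous_on (closure (span {tensor \<phi> d | (\<phi> :: 'n fock) d. d \<in> UNIV})) (\<lambda>x. A x - B x)"
      by (rule linear_continuous_on[OF lin])
    show "A y - B y = 0" if "y \<in> span {tensor \<phi> d | (\<phi> :: 'n fock) d. d \<in> UNIV}" for y
      by (rule linear_eq_0_on_span[OF bounded_linear.linear[OF lin] _ that]) (auto simp: eq)
  qed
  then show "A x = B x"
    by simp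
qed

text \<open>A weighted composition acts on indices only and so commutes with tensoring; the definite
  description becomes an explicit operator.\<close>

lemma ampliation_pullback:
  assumes "contractive_weights c \<tau>"
  shows "ampliation (pullback c \<tau> :: 'n fock \<Rightarrow> 'n fock)
    = (pullback c \<tau> :: ('n, 'k::complex_hilbert) fock_tensor \<Rightarrow> _)"
proof -
  interpret contractive_weights c \<tau> by fact
  have tensor: "pullback c \<tau> (tensor \<phi> k) = tensor (pullback c \<tau> \<phi>) k" for \<phi> :: "'n fock" and k :: 'k
    by (rule l2_eqI) (simp add: coord_pullback coord_tensor scaleR_scaleC scaleC_scaleC scaleC_complex_def)
  show ?thesis
    unfolding ampliation_def
  proof (rule the_equality)
    show "bounded_clinear (pullback c \<tau>) \<and> (\<forall>\<phi> k. pullback c \<tau> (tensor \<phi> k) = tensor (pullback c \<tau> \<phi>) (k :: 'k))"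
      by (simp add: tensor bounded_clinear_pullback)
    fix A :: "('n, 'k) fock_tensor \<Rightarrow> ('n, 'k) fock_tensor"
    assume "bounded_clinear A \<and> (\<forall>\<phi> k. A (tensor \<phi> k) = tensor (pullback c \<tau> \<phi>) k)"
    then show "A = pullback c \<tau>"
      by (intro bounded_clinear_eq_on_tensors bounded_clinear_pullback) (auto simp: tensor)
  qed
qed

section \<open>Weighted shifts\<close>

text \<open>Pulling back along \<open>tl\<close> with these weights maps
  \<open>fock_basis \<alpha>\<close> to \<open>w \<alpha>\<close> times
  \<open>fock_basis (i # \<alpha>)\<close>. Since \<open>tl [] = []\<close>, the empty word must get
  weight 0 explicitly.\<close>

definition shift_weight :: "('n list \<Rightarrow> real) \<Rightarrow> 'n \<Rightarrow> 'n list \<Rightarrow> real" where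
  "shift_weight w i \<beta> = (if \<beta> \<noteq> [] \<and> hd \<beta> = i then w (tl \<beta>) else 0)"

lemma shift_weight_simps [simp]:
  "shift_weight w i [] = 0" "shift_weight w i (j # \<alpha>) = (if j = i then w \<alpha> else 0)"
  by (auto simp: shift_weight_def)

lemma contractive_weights_shift:
  fixes w :: "'n::finite list \<Rightarrow> real"
  assumes "\<And>\<alpha>. \<bar>w \<alpha>\<bar> \<le> 1"
  shows "contractive_weights (shift_weight w i) tl"
proof
  fix \<gamma> :: "'n list"
  \<comment> \<open>The extra \<open>[]\<close> accounts for \<open>tl [] = []\<close>.\<close>
  have sub: "{\<beta>. tl \<beta> = \<gamma>} \<subseteq> insert [] (range (\<lambda>i. i # \<gamma>))"
    by (auto simp: image_iff) (metis list.collapse)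
  then show fin: "finite {\<beta>. tl \<beta> = \<gamma>}"
    by (rule finite_subset) simp
  have "(\<Sum>\<beta> | tl \<beta> = \<gamma>. (shift_weight w i \<beta>)\<^sup>2) = (\<Sum>\<beta>\<in>{i # \<gamma>}. (shift_weight w i \<beta>)\<^sup>2)"
    using fin by (intro sum.mono_neutral_right) (auto simp: shift_weight_def)
  also have "\<dots> \<le> 1"
    using assms[of \<gamma>] by (simp add: abs_square_le_1)
  finally show "(\<Sum>\<beta> | tl \<beta> = \<gamma>. (shift_weight w i \<beta>)\<^sup>2) \<le> 1" .
qed

section \<open>Left creation operators and the universal model as weighted shifts\<close>

lemma left_creation_eq:
  fixes i :: 'n
  shows "left_creation i = pullback (shift_weight (\<lambda>_. 1) i) tl"
proof
  fix \<phi> :: "'n fock"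
  have "(case \<beta> of [] \<Rightarrow> 0 | j # \<alpha> \<Rightarrow> if j = i then coord \<phi> \<alpha> else 0)
      = shift_weight (\<lambda>_. 1) i \<beta> *\<^sub>R coord \<phi> (tl \<beta>)" for \<beta>
    by (cases \<beta>) auto
  then show "left_creation i \<phi> = pullback (shift_weight (\<lambda>_. 1) i) tl \<phi>"
    by (simp add: left_creation_def pullback_def)
qed

interpretation shift: contractive_weights "shift_weight (\<lambda>_. 1) (i :: 'n::finite)" tl
  by (rule contractive_weights_shift) simp

lemma universal_model_eq:
  fixes b :: "'n::finite list \<Rightarrow> real"
  assumes "\<And>\<alpha>. b \<alpha> > 0" "\<And>\<alpha>. b \<alpha> / b (i # \<alpha>) \<le> 1"
  shows "universal_model b i = pullback (shift_weight (\<lambda>\<alpha>. sqrt (b \<alpha> / b (i # \<alpha>))) i) tl"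
proof
  fix \<phi> :: "'n fock"
  \<comment> \<open>The diagonal factor is a pullback along the identity, with singleton
    fibres.\<close>
  interpret weight: contractive_weights "\<lambda>\<alpha>. sqrt (b \<alpha> / b (i # \<alpha>))" id
  proof
    have [simp]: "{\<beta>. id \<beta> = \<alpha>} = {\<alpha>}" for \<alpha> :: "'n list"
      by auto
    show "finite {\<beta>. id \<beta> = \<alpha>}" "(\<Sum>\<beta> | id \<beta> = \<alpha>. (sqrt (b \<beta> / b (i # \<beta>)))\<^sup>2) \<le> 1" for \<alpha>
      using assms by (simp_all add: less_imp_le)
  qed
  interpret model: contractive_weights "shift_weight (\<lambda>\<alpha>. sqrt (b \<alpha> / b (i # \<alpha>))) i" tl
    using assms by (intro contractive_weights_shift) (simp add: less_imp_le)
  have "weight_op b i \<phi> = pullback (\<lambda>\<alpha>. sqrt (b \<alpha> / b (i # \<alpha>))) id \<phi>"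
    by (simp add: weight_op_def pullback_def)
  then show "universal_model b i \<phi> = pullback (shift_weight (\<lambda>\<alpha>. sqrt (b \<alpha> / b (i # \<alpha>))) i) tl \<phi>"
    by (intro l2_eqI) (simp add: universal_model_def left_creation_eq shift.coord_pullback
        weight.coord_pullback model.coord_pullback shift_weight_def)
qed

text \<open>Each coordinate of the shifted vector is 0 or a coordinate of \<open>x\<close>.\<close>

lemma shift_fock_tensor_space:
  assumes "csubspace D" "closed D" and "x \<in> (fock_tensor_space D :: ('n::finite, 'd::complex_hilbert) fock_tensor set)"
  shows "ampliation (left_creation i) x \<in> fock_tensor_space D"
proof -
  have "0 \<in> D"
    using assms(1) by (simp add: csubspace_def subspace_def)
  then show ?thesis
    using assms(3) unfolding fock_tensor_space_eq[OF assms(1,2)]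
    by (simp add: left_creation_eq ampliation_pullback[OF shift.contractive_weights_axioms]
        shift.coord_pullback shift_weight_def)
qed

text \<open>Only words beginning with \<open>i\<close> contribute to the shifted series; removing
  that letter by reindexing brings \<open>V i\<close> out of the sum.\<close>

lemma (in invariant_subspace) wold_shift:
  assumes "y \<in> wandering_fock"
  shows "wold (ampliation (left_creation i) y) = V i (wold y)"
proof -
  have lin0: "word_op V \<alpha> 0 = 0" for \<alpha>
    by (rule linear_0[OF bounded_linear.linear[OF bounded_clinear_linear[OF bounded_clinear_word]]])
  have "wold (ampliation (left_creation i) y)
      = (\<Sum>\<^sub>\<infinity>\<beta>. word_op V \<beta> (shift_weight (\<lambda>_. 1) i \<beta> *\<^sub>R coord y (tl \<beta>)))"
    by (simp add: wold_def left_creation_eq ampliation_pullback[OF shift.contractive_weights_axioms]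
        shift.coord_pullback)
  also have "\<dots> = (\<Sum>\<^sub>\<infinity>\<beta>\<in>range ((#) i). word_op V \<beta> (coord y (tl \<beta>)))"
  proof (rule infsum_cong_neutral)
    show "word_op V \<beta> (shift_weight (\<lambda>_. 1) i \<beta> *\<^sub>R coord y (tl \<beta>)) = 0"
      if "\<beta> \<in> UNIV - range ((#) i)" for \<beta>
    proof -
      have "shift_weight (\<lambda>_. 1) i \<beta> = 0"
        using that by (cases \<beta>) auto
      then show ?thesis
        by (simp add: lin0)
    qed
  qed auto
  also have "\<dots> = (\<Sum>\<^sub>\<infinity>\<alpha>. V i (word_op V \<alpha> (coord y \<alpha>)))"
    by (subst infsum_reindex) (auto simp: o_def)
  also have "\<dots> = V i (wold y)"
    unfolding wold_def
    by (rule infsumI[OF has_sum_bounded_linear[OF bounded_clinear_linear[OF bounded_clinear_V]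
          has_sum_infsum[OF wold_summable[OF assms]]]])
  finally show ?thesis .
qed

section \<open>The row isometry on pairs of words\<close>

text \<open>
  The isometric dilation of the universal model lives on families indexed by pairs of words. Pairs
  are coded as words, so that the dilation space is again a Fock tensor space over \<open>'k\<close>.
\<close>

definition pair_word :: "'n list \<times> 'n list \<Rightarrow> 'n list" where
  "pair_word = (SOME f. bij f)"

definition left :: "'n list \<Rightarrow> 'n list" where
  "left w = fst (inv pair_word w)"

definition right :: "'n list \<Rightarrow> 'n list" where
  "right w = snd (inv pair_word w)"

text \<open>The set of words is infinite, hence equinumerous with its square.\<close>

lemma bij_pair_word: "bij (pair_word :: 'n list \<times> 'n list \<Rightarrow> 'n list)"
proof -
  obtain f :: "'n list \<times> 'n list \<Rightarrow> 'n list" where "bij_betw f (UNIV \<times> UNIV) UNIV"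
    using card_of_Times_same_infinite[OF infinite_UNIV_listI] card_of_ordIso by blast
  then have "bij f"
    by simp
  then show ?thesis
    unfolding pair_word_def by (rule someI[where P = bij])
qed

lemma left_pair_word [simp]: "left (pair_word (\<alpha>, \<gamma>)) = \<alpha>"
  and right_pair_word [simp]: "right (pair_word (\<alpha>, \<gamma>)) = \<gamma>"
  by (simp_all add: left_def right_def inv_f_f[OF bij_is_inj[OF bij_pair_word]])

lemma pair_word_left_right [simp]: "pair_word (left w, right w) = w"
  by (simp add: left_def right_def surj_f_inv_f[OF bij_is_surj[OF bij_pair_word]])

lemma word_eqI: "left w = left w' \<Longrightarrow> right w = right w' \<Longrightarrow> w = w'"
  by (metis pair_word_left_right)

definition cons_left :: "'n \<Rightarrow> 'n list \<Rightarrow> 'n list" where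
  "cons_left i w = pair_word (i # left w, right w)"

definition tl_left :: "'n list \<Rightarrow> 'n list" where
  "tl_left w = pair_word (tl (left w), right w)"

text \<open>The shift in the first of two Fock factors: it prepends \<open>i\<close> to the left
  word and keeps the right one.\<close>

definition dilation_shift :: "'n::finite \<Rightarrow> ('n, 'k::complex_hilbert) fock_tensor \<Rightarrow> ('n, 'k) fock_tensor" where
  "dilation_shift i = pullback (\<lambda>w. shift_weight (\<lambda>_. 1) i (left w)) tl_left"

lemma cons_left_simps [simp]:
  "left (cons_left i w) = i # left w" "right (cons_left i w) = right w" "tl_left (cons_left i w) = w"
  by (simp_all add: cons_left_def tl_left_def)

lemma inj_cons_left: "inj (cons_left i)"
  by (metis cons_left_simps(3) injI)

lemma shift_weight_left_eq_0: "w \<notin> range (cons_left i) \<Longrightarrow> shift_weight v i (left w) = 0"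
proof (cases "left w")
  case (Cons j \<alpha>)
  assume "w \<notin> range (cons_left i)"
  moreover have "w = cons_left j (tl_left w)"
    by (rule word_eqI) (simp_all add: Cons tl_left_def)
  ultimately have "j \<noteq> i"
    by auto
  with Cons show ?thesis
    by simp
qed simp

interpretation dilation_shift: contractive_weights "\<lambda>w. shift_weight (\<lambda>_. 1) (i :: 'n::finite) (left w)" tl_left
proof
  fix v :: "'n list"
  \<comment> \<open>Besides the words with a letter prepended, a code with empty left word is fixed
    by \<open>tl_left\<close>.\<close>
  have "{w. tl_left w = v} \<subseteq> insert (pair_word ([], right v)) (range (\<lambda>i. cons_left i v))"
  proof
    fix w assume "w \<in> {w. tl_left w = v}"
    then have v: "v = tl_left w"
      by simp
    show "w \<in> insert (pair_word ([], right v)) (range (\<lambda>i. cons_left i v))"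
    proof (cases "left w")
      case Nil
      have "w = pair_word ([], right v)"
        by (rule word_eqI) (simp_all add: Nil v tl_left_def)
      then show ?thesis
        by simp
    next
      case (Cons j \<alpha>)
      have "w = cons_left j v"
        by (rule word_eqI) (simp_all add: Cons v tl_left_def)
      then show ?thesis
        by simp
    qed
  qed
  then show fin: "finite {w. tl_left w = v}"
    by (rule finite_subset) simp
  have "(\<Sum>w | tl_left w = v. (shift_weight (\<lambda>_. 1) i (left w))\<^sup>2)
      = (\<Sum>w\<in>{cons_left i v}. (shift_weight (\<lambda>_. 1) i (left w))\<^sup>2)"
  proof (rule sum.mono_neutral_right[OF fin])
    show "\<forall>w\<in>{w. tl_left w = v} - {cons_left i v}. (shift_weight (\<lambda>_. 1) i (left w))\<^sup>2 = 0"
    proof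
      fix w assume "w \<in> {w. tl_left w = v} - {cons_left i v}"
      then have "w \<notin> range (cons_left i)"
        by auto
      then show "(shift_weight (\<lambda>_. 1) i (left w))\<^sup>2 = 0"
        by (simp add: shift_weight_left_eq_0)
    qed
  qed simp
  then show "(\<Sum>w | tl_left w = v. (shift_weight (\<lambda>_. 1) i (left w))\<^sup>2) \<le> 1"
    by simp
qed

lemma coord_dilation_shift:
  "coord (dilation_shift i x) w = shift_weight (\<lambda>_. 1) i (left w) *\<^sub>R coord x (tl_left w)"
  unfolding dilation_shift_def by (rule dilation_shift.coord_pullback)

text \<open>For equal letters, reindex along \<open>cons_left i\<close>; for different letters the
  supports are disjoint.\<close>

lemma inner_dilation_shift:
  "inner (dilation_shift i x) (dilation_shift j y) = (if i = j then inner x y else 0)"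
proof (cases "i = j")
  case True
  have "inner (dilation_shift i x) (dilation_shift i y)
      = (\<Sum>\<^sub>\<infinity>w\<in>range (cons_left i). inner (coord x (tl_left w)) (coord y (tl_left w)))"
    unfolding inner_l2_def
    by (rule infsum_cong_neutral) (auto simp: coord_dilation_shift shift_weight_left_eq_0)
  also have "\<dots> = inner x y"
    unfolding inner_l2_def by (subst infsum_reindex[OF inj_cons_left]) (simp add: o_def)
  finally show ?thesis
    using True by simp
next
  case False
  have "inner (coord (dilation_shift i x) w) (coord (dilation_shift j y) w) = 0" for w
    using False by (cases "left w") (auto simp: coord_dilation_shift)
  then show ?thesis
    using False by (simp add: inner_l2_def)
qed

interpretation dilation: pure_row_isometry
  "dilation_shift :: 'n::finite \<Rightarrow> ('n, 'k::complex_hilbert) fock_tensor \<Rightarrow> ('n, 'k) fock_tensor"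
proof
  show "bounded_clinear (dilation_shift i :: ('n, 'k) fock_tensor \<Rightarrow> ('n, 'k) fock_tensor)" for i
    unfolding dilation_shift_def by (rule dilation_shift.bounded_clinear_pullback)
  show "inner (dilation_shift i x) (dilation_shift j y) = (if i = j then inner x y else 0)"
    for i j and x y :: "('n, 'k) fock_tensor"
    by (rule inner_dilation_shift)
  fix X :: "('n, 'k) fock_tensor set"
  assume X: "\<And>x. x \<in> X \<Longrightarrow> \<exists>y. (\<forall>i. y i \<in> X) \<and> x = (\<Sum>i\<in>UNIV. dilation_shift i (y i))"
  have sum: "coord (\<Sum>i\<in>UNIV. dilation_shift i (y i)) w = (\<Sum>i\<in>UNIV. coord (dilation_shift i (y i)) w)"
    for w and y :: "'n \<Rightarrow> ('n, 'k) fock_tensor"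
    using finite by (induction rule: finite_induct) (simp_all add: coord_simps)
  \<comment> \<open>Purity by induction on the left word: sums of shifts vanish where it is empty,
    and elsewhere a coordinate is governed by those of the \<open>y i\<close>, again in
    \<open>X\<close>, at a shorter left word.\<close>
  have "coord x w = 0" if "x \<in> X" for x w
    using that
  proof (induction "left w" arbitrary: x w)
    case Nil
    obtain y where "x = (\<Sum>i\<in>UNIV. dilation_shift i (y i))"
      using X[OF Nil.prems] by auto
    then show ?case
      by (simp add: sum coord_dilation_shift Nil.hyps[symmetric])
  next
    case (Cons j \<alpha>)
    obtain y where y: "\<And>i. y i \<in> X" "x = (\<Sum>i\<in>UNIV. dilation_shift i (y i))"
      using X[OF Cons.prems] by auto
    have "left (tl_left w) = \<alpha>"
      by (simp add: tl_left_def Cons.hyps(2)[symmetric])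
    then have "coord (y i) (tl_left w) = 0" for i
      using Cons.hyps(1) y(1) by simp
    then show ?case
      by (simp add: y(2) sum coord_dilation_shift)
  qed
  then show "X \<subseteq> {0}"
    by (auto intro!: l2_eqI simp: coord_zero)
qed

section \<open>The coisometry onto the model space\<close>

definition increment :: "('n list \<Rightarrow> real) \<Rightarrow> 'n list \<Rightarrow> real" where
  "increment b \<gamma> = (if \<gamma> = [] then b [] else b \<gamma> - b (tl \<gamma>))"

definition dilation_weight :: "('n list \<Rightarrow> real) \<Rightarrow> 'n list \<Rightarrow> real" where
  "dilation_weight b w = sqrt (increment b (right w) / b (left w @ right w))"

abbreviation word_concat :: "'n list \<Rightarrow> 'n list" where
  "word_concat w \<equiv> left w @ right w"

section \<open>Splittings of a word and telescoping increments\<close>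

lemma fibre_word_concat:
  "{w. word_concat w = \<beta>} = (\<lambda>k. pair_word (take k \<beta>, drop k \<beta>)) ` {..length \<beta>}"
proof (intro set_eqI iffI)
  fix w assume "w \<in> {w. word_concat w = \<beta>}"
  then have "take (length (left w)) \<beta> = left w" "drop (length (left w)) \<beta> = right w" "length (left w) \<le> length \<beta>"
    by auto
  then have "w = pair_word (take (length (left w)) \<beta>, drop (length (left w)) \<beta>)" "length (left w) \<le> length \<beta>"
    by simp_all
  then show "w \<in> (\<lambda>k. pair_word (take k \<beta>, drop k \<beta>)) ` {..length \<beta>}"
    by blast
qed auto

lemma inj_on_split: "inj_on (\<lambda>k. pair_word (take k \<beta>, drop k \<beta>)) {..length \<beta>}"
proof (rule inj_onI)
  fix k l
  assume kl: "k \<in> {..length \<beta>}" "l \<in> {..length \<beta>}"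
    and "pair_word (take k \<beta>, drop k \<beta>) = pair_word (take l \<beta>, drop l \<beta>)"
  then have "left (pair_word (take k \<beta>, drop k \<beta>)) = left (pair_word (take l \<beta>, drop l \<beta>))"
    by simp
  then have "length (take k \<beta>) = length (take l \<beta>)"
    by simp
  then show "k = l"
    using kl by simp
qed

text \<open>The increment at each suffix subtracts the value of \<open>b\<close> at the next shorter
  one.\<close>

lemma sum_increment: "(\<Sum>k\<le>length \<beta>. increment b (drop k \<beta>)) = b \<beta>"
proof (induction \<beta>)
  case (Cons a \<beta>)
  have "(\<Sum>k\<le>length (a # \<beta>). increment b (drop k (a # \<beta>)))
      = increment b (a # \<beta>) + (\<Sum>k\<le>length \<beta>. increment b (drop k \<beta>))"
    by (simp add: sum.atMost_Suc_shift del: sum.atMost_Suc)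
  also have "\<dots> = b (a # \<beta>)"
    unfolding Cons.IH by (simp add: increment_def)
  finally show ?case .
qed (simp add: increment_def)

text \<open>The ratio bound says that \<open>b\<close> does not decrease when a letter is prepended,
  which makes the increments nonnegative.\<close>

locale monotone_weights =
  fixes b :: "'n::finite list \<Rightarrow> real"
  assumes pos: "b \<alpha> > 0" and ratio_le: "b \<alpha> / b (i # \<alpha>) \<le> 1"
begin

lemma increment_nonneg: "increment b \<gamma> \<ge> 0"
proof (cases \<gamma>)
  case (Cons i \<alpha>)
  then show ?thesis
    using ratio_le[of \<alpha> i] pos[of \<gamma>] by (simp add: increment_def)
qed (simp add: increment_def pos less_imp_le)

text \<open>On the fibre the denominator is constantly \<open>b \<beta>\<close>, so the telescoping
  sum applies. This is the coisometry condition.\<close>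

lemma sum_dilation_weight: "(\<Sum>w | word_concat w = \<beta>. (dilation_weight b w)\<^sup>2) = 1"
proof -
  have "(\<Sum>w | word_concat w = \<beta>. (dilation_weight b w)\<^sup>2)
      = (\<Sum>w | word_concat w = \<beta>. increment b (right w) / b \<beta>)"
    using pos by (intro sum.cong) (auto simp: dilation_weight_def increment_nonneg less_imp_le)
  also have "\<dots> = (\<Sum>k\<le>length \<beta>. increment b (drop k \<beta>)) / b \<beta>"
    unfolding fibre_word_concat by (subst sum.reindex[OF inj_on_split]) (simp add: sum_divide_distrib)
  also have "\<dots> = 1"
    using pos[of \<beta>] by (simp add: sum_increment)
  finally show ?thesis .
qed

sublocale coisometry: contractive_weights "dilation_weight b" word_concat
proof
  show "finite {w. word_concat w = \<beta>}" "(\<Sum>w | word_concat w = \<beta>. (dilation_weight b w)\<^sup>2) \<le> 1" for \<beta>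
    by (simp_all only: sum_dilation_weight order.refl) (simp add: fibre_word_concat)
qed

sublocale model: contractive_weights "shift_weight (\<lambda>\<alpha>. sqrt (b \<alpha> / b (i # \<alpha>))) i" tl for i
  using pos ratio_le by (intro contractive_weights_shift) (simp add: less_imp_le)

section \<open>The coisometry and its intertwining relation\<close>

lemma coord_model:
  "coord (ampliation (universal_model b i) x) \<beta>
    = shift_weight (\<lambda>\<alpha>. sqrt (b \<alpha> / b (i # \<alpha>))) i \<beta> *\<^sub>R coord x (tl \<beta>)"
  by (simp add: universal_model_eq[of b, OF pos ratio_le] model.coord_pullback
      ampliation_pullback[OF model.contractive_weights_axioms])

definition coisometry :: "('n, 'k::complex_hilbert) fock_tensor \<Rightarrow> ('n, 'k) fock_tensor" where
  "coisometry = pushforward (dilation_weight b) word_concat"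

text \<open>Prepending to the left word changes only the denominator, and the resulting factor is
  exactly the weight of the universal model.\<close>

lemma dilation_weight_cons_left:
  "dilation_weight b (cons_left i w)
    = sqrt (b (word_concat w) / b (i # word_concat w)) * dilation_weight b w"
  using pos[of "word_concat w"] by (simp add: dilation_weight_def real_sqrt_mult[symmetric])

lemma coisometry_dilation_shift:
  "coisometry (dilation_shift i y) = ampliation (universal_model b i) (coisometry y)"
proof (rule l2_eqI)
  fix \<beta>
  have lhs: "coord (coisometry (dilation_shift i y)) \<beta>
      = (\<Sum>w | word_concat w = \<beta>. dilation_weight b w *\<^sub>R shift_weight (\<lambda>_. 1) i (left w) *\<^sub>R coord y (tl_left w))"
    by (simp add: coisometry_def coisometry.coord_pushforward coord_dilation_shift)
  show "coord (coisometry (dilation_shift i y)) \<beta> = coord (ampliation (universal_model b i) (coisometry y)) \<beta>"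
  proof (cases "\<exists>\<alpha>. \<beta> = i # \<alpha>")
    case False
    then have "shift_weight (\<lambda>_. 1) i (left w) = 0" if "word_concat w = \<beta>" for w
      using that by (cases "left w") auto
    moreover have "shift_weight (\<lambda>\<alpha>. sqrt (b \<alpha> / b (i # \<alpha>))) i \<beta> = 0"
      using False by (cases \<beta>) auto
    ultimately show ?thesis
      by (simp add: lhs coord_model)
  next
    case True
    then obtain \<alpha> where \<beta>: "\<beta> = i # \<alpha>" by auto
    \<comment> \<open>The fibre over \<open>i # \<alpha>\<close> also contains the splitting with
      empty left word, but the shift weight vanishes there.\<close>
    have "coord (coisometry (dilation_shift i y)) \<beta>
        = (\<Sum>w\<in>cons_left i ` {w. word_concat w = \<alpha>}.
            dilation_weight b w *\<^sub>R shift_weight (\<lambda>_. 1) i (left w) *\<^sub>R coord y (tl_left w))"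
      unfolding lhs
    proof (rule sum.mono_neutral_right[OF coisometry.finite_fibre])
      show "\<forall>w\<in>{w. word_concat w = \<beta>} - cons_left i ` {w. word_concat w = \<alpha>}.
          dilation_weight b w *\<^sub>R shift_weight (\<lambda>_. 1) i (left w) *\<^sub>R coord y (tl_left w) = 0"
      proof
        fix w assume "w \<in> {w. word_concat w = \<beta>} - cons_left i ` {w. word_concat w = \<alpha>}"
        then have "w \<notin> range (cons_left i)"
          by (auto simp: \<beta>)
        then show "dilation_weight b w *\<^sub>R shift_weight (\<lambda>_. 1) i (left w) *\<^sub>R coord y (tl_left w) = 0"
          by (simp add: shift_weight_left_eq_0)
      qed
    qed (auto simp: \<beta>)
    also have "\<dots> = (\<Sum>w | word_concat w = \<alpha>. dilation_weight b (cons_left i w) *\<^sub>R coord y w)"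
      by (subst sum.reindex) (auto intro: inj_on_subset[OF inj_cons_left])
    also have "\<dots> = (\<Sum>w | word_concat w = \<alpha>. sqrt (b \<alpha> / b (i # \<alpha>)) *\<^sub>R dilation_weight b w *\<^sub>R coord y w)"
      by (rule sum.cong) (auto simp: dilation_weight_cons_left)
    also have "\<dots> = coord (ampliation (universal_model b i) (coisometry y)) \<beta>"
      by (simp add: coord_model \<beta> coisometry_def coisometry.coord_pushforward scaleR_sum_right)
    finally show ?thesis .
  qed
qed

section \<open>The coisometry as a partial isometry\<close>

lemma bounded_clinear_coisometry: "bounded_clinear coisometry"
  unfolding coisometry_def by (rule coisometry.bounded_clinear_pushforward)

lemmas bounded_linear_coisometry = bounded_clinear_linear[OF bounded_clinear_coisometry]

lemma norm_coisometry_le: "norm (coisometry z) \<le> norm z"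
  unfolding coisometry_def by (rule coisometry.norm_pushforward_le)

text \<open>The preimage is the adjoint pullback applied to \<open>x\<close>.\<close>

lemma coisometry_section:
  obtains y where "coisometry y = x" "norm y \<le> norm x"
  using coisometry.pushforward_pullback[OF sum_dilation_weight] coisometry.norm_pullback_le
  unfolding coisometry_def by metis

text \<open>A preimage \<open>y\<close> of \<open>coisometry z\<close> with small norm differs from
  \<open>z\<close> by a kernel vector. Hence the squared norm of \<open>z\<close> is
  \<open>inner z y\<close>, and Cauchy-Schwarz applies.\<close>

lemma norm_coisometry_eq:
  assumes "\<And>v. coisometry v = 0 \<Longrightarrow> inner z v = 0"
  shows "norm (coisometry z) = norm z"
proof -
  obtain y where y: "coisometry y = coisometry z" "norm y \<le> norm (coisometry z)"
    by (rule coisometry_section)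
  have "coisometry (z - y) = 0"
    by (simp add: linear_diff[OF bounded_linear.linear[OF bounded_linear_coisometry]] y(1))
  then have "norm z * norm z = inner z y"
    using assms[of "z - y"] by (simp add: inner_diff_right dot_square_norm power2_eq_square)
  also have "\<dots> \<le> norm z * norm (coisometry z)"
    using norm_cauchy_schwarz[of z y] mult_left_mono[OF y(2), of "norm z"] by simp
  finally have "norm z \<le> norm (coisometry z)"
    by (cases "norm z = 0") (simp_all add: mult_le_cancel_left)
  then show ?thesis
    using norm_coisometry_le[of z] by simp
qed

text \<open>The witnesses are the wandering subspace of the preimage of \<open>M\<close> and the
  coisometry composed with the Wold map.\<close>

lemma invariant_subspace_representation:
  fixes M :: "('n, 'k::complex_hilbert) fock_tensor set"
  assumes M: "csubspace M" "closed M" and inv: "\<forall>i. ampliation (universal_model b i) ` M \<subseteq> M"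
  shows "\<exists>(D :: ('n, 'k) fock_tensor set)
         (\<Psi> :: ('n, ('n, 'k) fock_tensor) fock_tensor \<Rightarrow> ('n, 'k) fock_tensor).
         csubspace D \<and> closed D \<and> partial_isometry_on (fock_tensor_space D) \<Psi> \<and>
         M = \<Psi> ` fock_tensor_space D \<and>
         (\<forall>i. \<forall>x\<in>fock_tensor_space D.
            \<Psi> (ampliation (left_creation i) x) = ampliation (universal_model b i) (\<Psi> x))"
proof -
  note lin = bounded_linear.linear[OF bounded_linear_coisometry]
  define N :: "('n, 'k) fock_tensor set" where "N = coisometry -` M"
  interpret N: invariant_subspace dilation_shift N
  proof
    show "csubspace N"
      using M(1) by (simp add: csubspace_def N_def linear_subspace_vimage[OF lin]
          bounded_clinear_scaleC[OF bounded_clinear_coisometry])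
    show "closed N"
      unfolding N_def using M(2) linear_continuous_on[OF bounded_linear_coisometry]
      by (rule closed_vimage)
    show "dilation_shift i x \<in> N" if "x \<in> N" for i x
      using that inv by (auto simp: N_def coisometry_dilation_shift)
  qed
  define \<Psi> where "\<Psi> = coisometry \<circ> N.wold"
  have "M = coisometry ` N"
  proof (intro equalityI subsetI)
    fix x assume "x \<in> M"
    moreover obtain y where "coisometry y = x"
      by (rule coisometry_section)
    ultimately show "x \<in> coisometry ` N"
      by (auto simp: N_def)
  qed (auto simp: N_def)
  then have image: "M = \<Psi> ` N.wandering_fock"
    unfolding \<Psi>_def image_comp[symmetric] N.wold_image .
  \<comment> \<open>The kernel of the coisometry lies in \<open>N\<close> because \<open>M\<close>
    contains 0, so the Wold map reaches it and the orthogonality assumed of \<open>x\<close> can be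
    transported to \<open>N.wold x\<close>.\<close>
  have "norm (\<Psi> x) = norm x"
    if x: "x \<in> N.wandering_fock" and orth: "\<forall>y\<in>N.wandering_fock. \<Psi> y = 0 \<longrightarrow> cinner x y = 0" for x
  proof -
    have "norm (coisometry (N.wold x)) = norm (N.wold x)"
    proof (rule norm_coisometry_eq)
      fix v :: "('n, 'k) fock_tensor"
      assume v: "coisometry v = 0"
      then have "v \<in> N"
        using M(1) by (simp add: N_def csubspace_def subspace_def)
      then obtain y where y: "y \<in> N.wandering_fock" "v = N.wold y"
        using N.wold_image by auto
      have "inner x y = 0"
        using orth y v by (simp add: \<Psi>_def inner_eq_Re_cinner)
      then show "inner (N.wold x) v = 0"
        \<comment> \<open>Polarisation: the Wold map preserves norms and sums, hence inner
          products.\<close>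
        using x y by (simp add: dot_norm N.wold_add[symmetric] N.norm_wold
            subspace_add[OF N.subspace_wandering_fock])
    qed
    then show ?thesis
      by (simp add: \<Psi>_def N.norm_wold[OF x])
  qed
  moreover have "norm (\<Psi> x) \<le> 1 * norm x" if "x \<in> N.wandering_fock" for x
    using norm_coisometry_le[of "N.wold x"] by (simp add: \<Psi>_def N.norm_wold[OF that])
  ultimately have "partial_isometry_on N.wandering_fock \<Psi>"
    unfolding partial_isometry_on_def \<Psi>_def
    by (auto simp: N.wold_add N.wold_scaleC linear_add[OF lin]
        bounded_clinear_scaleC[OF bounded_clinear_coisometry] intro!: exI[of _ 1])
  moreover have "\<Psi> (ampliation (left_creation i) x) = ampliation (universal_model b i) (\<Psi> x)"
    if "x \<in> N.wandering_fock" for i x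
    by (simp add: \<Psi>_def N.wold_shift[OF that] coisometry_dilation_shift)
  ultimately show ?thesis
    using N.csubspace_wandering N.closed_wandering image
    by (intro exI[of _ N.wandering] exI[of _ \<Psi>]) auto
qed

end

text \<open>The shift preserves \<open>fock_tensor_space D\<close>, so \<open>W i\<close> maps the
  range of the intertwiner into itself. The type of \<open>D\<close> is arbitrary, to serve both
  converses in the theorem.\<close>

lemma intertwining_range_invariant:
  fixes D :: "'d::complex_hilbert set" and \<Psi> :: "('n::finite, 'd) fock_tensor \<Rightarrow> 'e"
  assumes "csubspace D" "closed D" and M: "M = \<Psi> ` fock_tensor_space D"
    and \<Psi>: "\<forall>i. \<forall>x\<in>fock_tensor_space D. \<Psi> (ampliation (left_creation i) x) = W i (\<Psi> x)"
  shows "W i ` M \<subseteq> M"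
proof
  fix y assume "y \<in> W i ` M"
  then obtain x where "x \<in> fock_tensor_space D" "y = W i (\<Psi> x)"
    unfolding M by blast
  then have "y = \<Psi> (ampliation (left_creation i) x)" "ampliation (left_creation i) x \<in> fock_tensor_space D"
    using \<Psi> shift_fock_tensor_space[OF assms(1,2)] by auto
  then show "y \<in> M"
    unfolding M by blast
qed

text \<open>The space \<open>D\<close> is asserted to exist inside the type of the Fock tensor space
  over \<open>'k\<close>, where the wandering subspace lives. As types cannot be quantified
  existentially, the second conjunct states the converse for \<open>D\<close> in any Hilbert space
  type.\<close>

theorem corollary2p5:
  fixes b :: "'n::finite list \<Rightarrow> real"
    and M :: "('n, 'k::complex_hilbert) fock_tensor set"
  assumes "admissible b"
    and "\<forall>i \<alpha>. b \<alpha> / b (i # \<alpha>) \<le> 1"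
    and "csubspace M" and "closed M"
  shows "((\<forall>i. ampliation (universal_model b i) ` M \<subseteq> M) \<longleftrightarrow>
      (\<exists>(D :: ('n, 'k) fock_tensor set)
         (\<Psi> :: ('n, ('n, 'k) fock_tensor) fock_tensor \<Rightarrow> ('n, 'k) fock_tensor).
         csubspace D \<and> closed D \<and>
         partial_isometry_on (fock_tensor_space D) \<Psi> \<and>
         M = \<Psi> ` fock_tensor_space D \<and>
         (\<forall>i. \<forall>x\<in>fock_tensor_space D.
            \<Psi> (ampliation (left_creation i) x) = ampliation (universal_model b i) (\<Psi> x))))
    \<and> (\<forall>(D :: 'd::complex_hilbert set)
         (\<Psi> :: ('n, 'd) fock_tensor \<Rightarrow> ('n, 'k) fock_tensor).
         csubspace D \<and> closed D \<and>
         partial_isometry_on (fock_tensor_space D) \<Psi> \<and>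
         M = \<Psi> ` fock_tensor_space D \<and>
         (\<forall>i. \<forall>x\<in>fock_tensor_space D.
            \<Psi> (ampliation (left_creation i) x) = ampliation (universal_model b i) (\<Psi> x))
         \<longrightarrow> (\<forall>i. ampliation (universal_model b i) ` M \<subseteq> M))"
proof -
  interpret monotone_weights b
  proof
    show "b \<alpha> > 0" for \<alpha>
      using assms(1) unfolding admissible_def by blast
    show "b \<alpha> / b (i # \<alpha>) \<le> 1" for i \<alpha>
      using assms(2) by blast
  qed
  show ?thesis
    apply (intro conjI iffI allI impI)
      apply (rule invariant_subspace_representation[OF assms(3,4)], assumption)
     apply (elim exE conjE, rule intertwining_range_invariant; assumption)
    apply (elim conjE, rule intertwining_range_invariant; assumption)
    done
qed

end
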